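(* Let $q>2$ be a prime power and let $\omega=x^M$ be the power word with $M=q-1$. Then for any $N$ and any $c>0$ there exists an integer $n\geqslant 2$ such that $G=\mathrm{PSL}_n(q)$ satisfies $|G|\geqslant N$ and $$|\omega(G)|<c\,|G|.$$
   Context: $\mathrm{PSL}_n(q)$ is the projective special linear group over the field $\mathbb{F}_q$ of $q$ elements. For the word $\omega=x^M$ and a group $G$, $\omega(G)=\{g^M : g\in G\}$ is the image of the $M$-th power map. A power word is a word of the form $\upsilon^m$ with $m>1$. *)

theory Defs
  imports
    "Jordan_Normal_Form.Determinant"
    "HOL-Algebra.Coset"
    "HOL-Number_Theory.Prime_Powers"
    "HOL-Library.Cardinality"
begin

definition SL :: "nat \<Rightarrow> 'a :: field mat monoid" where
  "SL n = \<lparr>carrier = {A \<in> carrier_mat n n. det A = 1}, mult = (*), one = 1\<^sub>m n\<rparr>"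

definition group_center :: "('g, 'h) monoid_scheme \<Rightarrow> 'g set" where
  "group_center G = {z \<in> carrier G. \<forall>g\<in>carrier G. z \<otimes>\<^bsub>G\<^esub> g = g \<otimes>\<^bsub>G\<^esub> z}"

definition PSL :: "nat \<Rightarrow> 'a :: field mat set monoid" where
  "PSL n = SL n Mod group_center (SL n)"

definition power_word_image :: "nat \<Rightarrow> ('g, 'h) monoid_scheme \<Rightarrow> 'g set" where
  "power_word_image M G = {g [^]\<^bsub>G\<^esub> M | g. g \<in> carrier G}"

lemma group_SL: "group (SL n :: 'a :: field mat monoid)"
proof (rule groupI)
  fix A :: "'a mat"
  assume "A \<in> carrier (SL n)"
  then have A: "A \<in> carrier_mat n n" and d: "det A = 1"
    by (auto simp: SL_def)
  have adj: "adj_mat A \<in> carrier_mat n n" "adj_mat A * A = 1\<^sub>m n"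
    using adj_mat[OF A] d by auto
  then have "det (adj_mat A) * det A = 1"
    using det_mult[OF adj(1) A] by simp
  with adj d show "\<exists>B\<in>carrier (SL n). B \<otimes>\<^bsub>SL n\<^esub> A = \<one>\<^bsub>SL n\<^esub>"
    by (auto simp: SL_def)
qed (auto simp: SL_def det_mult)

lemma (in group) group_center_normal: "group_center G \<lhd> G"
proof -
  have "subgroup (group_center G) G"
  proof (rule subgroupI)
    show "group_center G \<subseteq> carrier G"
      by (auto simp: group_center_def)
    show "group_center G \<noteq> {}"
    proof -
      have "\<one> \<in> group_center G"
        by (simp add: group_center_def)
      then show ?thesis by blast
    qed
  next
    fix a assume "a \<in> group_center G"
    then have a: "a \<in> carrier G" "\<And>g. g \<in> carrier G \<Longrightarrow> a \<otimes> g = g \<otimes> a"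
      unfolding group_center_def by blast+
    have "inv a \<otimes> g = g \<otimes> inv a" if g: "g \<in> carrier G" for g
    proof -
      have "inv a \<otimes> g = inv a \<otimes> (g \<otimes> a) \<otimes> inv a"
        using g a(1) by (simp add: m_assoc)
      also have "\<dots> = g \<otimes> inv a"
        using g a(1) by (simp add: a(2)[OF g, symmetric] m_assoc[symmetric])
      finally show ?thesis .
    qed
    with a(1) show "inv a \<in> group_center G"
      by (simp add: group_center_def)
  next
    fix a b assume "a \<in> group_center G" "b \<in> group_center G"
    then have a: "a \<in> carrier G" "\<And>g. g \<in> carrier G \<Longrightarrow> a \<otimes> g = g \<otimes> a"
      and b: "b \<in> carrier G" "\<And>g. g \<in> carrier G \<Longrightarrow> b \<otimes> g = g \<otimes> b"
      unfolding group_center_def by blast+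
    have "a \<otimes> b \<otimes> g = g \<otimes> (a \<otimes> b)" if g: "g \<in> carrier G" for g
    proof -
      have "a \<otimes> b \<otimes> g = a \<otimes> (g \<otimes> b)"
        using a(1) b g by (simp add: m_assoc)
      also have "\<dots> = g \<otimes> a \<otimes> b"
        using a(1) b(1) g a(2)[OF g] by (metis m_assoc)
      finally show ?thesis
        using a(1) b(1) g by (simp add: m_assoc)
    qed
    with a(1) b(1) show "a \<otimes> b \<in> group_center G"
      by (simp add: group_center_def)
  qed
  moreover have "x \<otimes> h \<otimes> inv x \<in> group_center G"
    if "x \<in> carrier G" "h \<in> group_center G" for x h
  proof -
    have "h \<in> carrier G" "x \<otimes> h = h \<otimes> x"
      using that unfolding group_center_def by force+
    then have "x \<otimes> h \<otimes> inv x = h"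
      using that by (simp add: m_assoc)
    with that show ?thesis by simp
  qed
  ultimately show ?thesis
    by (auto simp: normal_inv_iff)
qed

lemma group_PSL: "group (PSL n :: 'a :: field mat set monoid)"
  unfolding PSL_def
  by (intro normal.factorgroup_is_group group.group_center_normal group_SL)

end

theory Submission
  imports
    Defs
    "Jordan_Normal_Form.Column_Operations"
    "HOL-Algebra.Group_Action"
    "HOL-Real_Asymp.Real_Asymp"
begin

text \<open>
  Put \<open>q = CARD('a)\<close> and \<open>m = q - 1\<close>. If \<open>R \<in> F[B]\<close> and \<open>R ^ m = 1\<close>, then \<open>(B R) ^ m = B ^ m\<close>,
  so the fibre of the power map through \<open>B \<in> SL n\<close> is, up to the factor \<open>q\<close> lost in making
  \<open>det R = 1\<close>, at least as large as the group of \<open>m\<close>-th roots of unity in \<open>F[B]\<close>. When \<open>K\<close>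
  irreducible polynomials divide the minimal polynomial of \<open>B\<close>, scaling any set of the primary
  components by a fixed \<open>l \<noteq> 0, 1\<close> yields \<open>2 ^ K\<close> such roots. So it suffices that most \<open>B\<close> have
  many irreducible factors; the centre of \<open>SL n\<close> only costs another factor \<open>q\<close>.

  For an irreducible \<open>f \<noteq> x\<close> let \<open>X f B\<close> count the embeddings of the module \<open>F[x]/(f)\<close> into the
  module \<open>F ^ n\<close> defined by \<open>B\<close>. Since \<open>SL n\<close> is transitive on injective \<open>n\<close> by \<open>k\<close> matrices
  for \<open>k < n\<close>, \<open>X f\<close> has mean exactly 1, \<open>X f * X g\<close> has mean at most 1 for \<open>f \<noteq> g\<close>, and
  \<open>(X f)^2\<close> has mean at most \<open>1 + q ^ deg f\<close>. As \<open>\<Sum>f. 1 / q ^ deg f\<close> diverges, Chebyshev's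
  inequality applies to arbitrarily many disjoint families of irreducible polynomials.
\<close>

section \<open>Monic irreducible polynomials\<close>

lemma bezout_poly:
  fixes a b :: "'a :: field poly"
  assumes "coprime a b"
  obtains u w where "u * a + w * b = 1"
proof -
  have "\<exists>u w. u * a + w * b = 1"
    using assms
  proof (induction "euclidean_size b" arbitrary: a b rule: less_induct)
    case less
    show ?case
    proof (cases "b = 0")
      case True
      with less.prems have "a dvd 1" by simp
      with True show ?thesis by (metis add_0_right dvdE mult.commute mult_zero_right)
    next
      case False
      have "coprime b (a mod b)"
        using less.prems False by (simp add: coprime_commute)
      moreover have "euclidean_size (a mod b) < euclidean_size b"
        using False by (rule mod_size_less)
      ultimately obtain u w where bezout_mod: "u * b + w * (a mod b) = 1"
        using less.hyps by blast
      have "a mod b = a - a div b * b"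
        by (simp add: minus_div_mult_eq_mod)
      with bezout_mod have "w * a + (u - w * (a div b)) * b = 1"
        by (simp add: algebra_simps)
      then show ?thesis by blast
    qed
  qed
  with that show thesis by blast
qed

definition monic_irreducibles :: "'a :: field poly set" where
  "monic_irreducibles = {f. irreducible f \<and> lead_coeff f = 1}"

lemma monic_irreduciblesD:
  assumes "f \<in> monic_irreducibles"
  shows "irreducible f" "lead_coeff f = 1" "f \<noteq> 0" "\<not> is_unit f" "degree f > 0"
  using assms is_unit_iff_degree[of f]
  by (auto simp: monic_irreducibles_def irreducible_not_unit intro: Nat.gr0I)

lemma X_in_monic_irreducibles: "[:0, 1:] \<in> monic_irreducibles"
  by (simp add: monic_irreducibles_def irreducible_linear_field_poly)

lemma monic_irreducible_dvd_mult_iff: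
  "f \<in> monic_irreducibles \<Longrightarrow> f dvd a * b \<longleftrightarrow> f dvd a \<or> f dvd b"
  by (intro prime_elem_dvd_mult_iff field_poly_irreducible_imp_prime monic_irreduciblesD)

lemma monic_irreducible_factor_exists:
  fixes p :: "'a :: field poly"
  assumes "degree p > 0"
  obtains f where "f \<in> monic_irreducibles" "f dvd p"
proof -
  have "\<exists>f\<in>monic_irreducibles. f dvd p"
    using assms
  proof (induction "degree p" arbitrary: p rule: less_induct)
    case less
    then have "p \<noteq> 0" by auto
    with less.prems have "\<not> is_unit p" by (simp add: is_unit_iff_degree)
    show ?case
    proof (cases "irreducible p")
      case True
      define f where "f = smult (inverse (lead_coeff p)) p"
      have "is_unit [:inverse (lead_coeff p):]"
        using \<open>p \<noteq> 0\<close> by (simp add: is_unit_const_poly_iff dvd_field_iff)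
      moreover have "f = [:inverse (lead_coeff p):] * p" by (simp add: f_def)
      ultimately have "irreducible f"
        using True by (simp only: irreducible_mult_unit_left)
      moreover have "lead_coeff f = 1" "f dvd p"
        using \<open>p \<noteq> 0\<close> by (simp_all add: f_def smult_dvd)
      ultimately show ?thesis unfolding monic_irreducibles_def by blast
    next
      case False
      with \<open>p \<noteq> 0\<close> \<open>\<not> is_unit p\<close> obtain a b
        where factors: "p = a * b" "\<not> is_unit a" "\<not> is_unit b"
        by (auto simp: irreducible_def)
      with \<open>p \<noteq> 0\<close> have "a \<noteq> 0" "b \<noteq> 0" by auto
      with factors have "degree a > 0" "degree b > 0" by (auto simp: is_unit_iff_degree)
      then have "degree a < degree p"
        using \<open>a \<noteq> 0\<close> \<open>b \<noteq> 0\<close> factors(1) by (simp add: degree_mult_eq)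
      from less.hyps[OF this \<open>degree a > 0\<close>] factors(1) show ?thesis by (metis dvd_mult2)
    qed
  qed
  with that show thesis by blast
qed

lemma coprime_polyI:
  fixes a b :: "'a :: field poly"
  assumes "a \<noteq> 0" and "\<And>f. f \<in> monic_irreducibles \<Longrightarrow> f dvd a \<Longrightarrow> f dvd b \<Longrightarrow> False"
  shows "coprime a b"
proof (rule coprimeI)
  fix c assume c: "c dvd a" "c dvd b"
  with assms(1) have "c \<noteq> 0" by auto
  have "degree c = 0"
  proof (rule ccontr)
    assume "degree c \<noteq> 0"
    then obtain f where "f \<in> monic_irreducibles" "f dvd c"
      using monic_irreducible_factor_exists by auto
    with c assms(2) show False by (meson dvd_trans)
  qed
  with \<open>c \<noteq> 0\<close> show "is_unit c" by (simp add: is_unit_iff_degree)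
qed

lemma monic_irreducibles_dvd_imp_eq:
  assumes f: "f \<in> monic_irreducibles" and g: "g \<in> monic_irreducibles" and "f dvd g"
  shows "f = g"
proof -
  obtain d where d: "g = f * d" using \<open>f dvd g\<close> by blast
  have "is_unit d"
    using irreducibleD[OF monic_irreduciblesD(1)[OF g] d] monic_irreduciblesD(4)[OF f] by blast
  then obtain c where "d = [:c:]" by (auto simp: is_unit_poly_iff)
  moreover have "lead_coeff d = 1"
    using d monic_irreduciblesD(2)[OF f] monic_irreduciblesD(2)[OF g] by (simp add: lead_coeff_mult)
  ultimately show ?thesis using d by (simp add: one_pCons[symmetric])
qed

lemma coprime_monic_irreducible_power:
  assumes f: "f \<in> monic_irreducibles" and "\<not> f dvd b"
  shows "coprime (f ^ j) b"
proof (rule coprime_polyI)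
  fix g assume g: "g \<in> monic_irreducibles" and "g dvd f ^ j" "g dvd b"
  then have "g dvd f"
    using prime_elem_dvd_power field_poly_irreducible_imp_prime monic_irreduciblesD(1) by blast
  with f g have "g = f" by (intro monic_irreducibles_dvd_imp_eq)
  with \<open>g dvd b\<close> \<open>\<not> f dvd b\<close> show False by simp
qed (use monic_irreduciblesD(3)[OF f] in simp)

lemma coprime_monic_irreducible:
  "f \<in> monic_irreducibles \<Longrightarrow> \<not> f dvd b \<Longrightarrow> coprime f b"
  using coprime_monic_irreducible_power[of f b 1] by simp

lemma split_off_power_poly:
  fixes f h :: "'a :: field poly"
  assumes f: "degree f > 0" and "h \<noteq> 0"
  obtains j b where "h = f ^ j * b" "\<not> f dvd b"
proof -
  have "\<exists>j b. h = f ^ j * b \<and> \<not> f dvd b"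
    using \<open>h \<noteq> 0\<close>
  proof (induction "degree h" arbitrary: h rule: less_induct)
    case less
    show ?case
    proof (cases "f dvd h")
      case False
      then show ?thesis by (metis mult_1 power_0)
    next
      case True
      then obtain k where k: "h = f * k" by blast
      with less.prems have "f \<noteq> 0" "k \<noteq> 0" by auto
      with f k have "degree k < degree h" by (simp add: degree_mult_eq)
      from less.hyps[OF this \<open>k \<noteq> 0\<close>] obtain j b where "k = f ^ j * b" "\<not> f dvd b"
        by blast
      with k have "h = f ^ Suc j * b" by (simp add: mult_ac)
      with \<open>\<not> f dvd b\<close> show ?thesis by blast
    qed
  qed
  with that show thesis by blast
qed

section \<open>Abundance of irreducible polynomials over a finite field\<close>

lemma two_le_CARD: "2 \<le> CARD('a :: {zero_neq_one, finite})"
proof -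
  have "card {0 :: 'a, 1} \<le> CARD('a)" by (intro card_mono) auto
  then show ?thesis by simp
qed

definition monics :: "nat \<Rightarrow> 'a :: field poly set" where
  "monics m = {p. degree p = m \<and> lead_coeff p = 1}"

lemma monics_Suc: "monics (Suc m) = (\<lambda>(a, p). pCons a p) ` (UNIV \<times> monics m)"
proof (intro equalityI subsetI)
  fix p :: "'a poly" assume p: "p \<in> monics (Suc m)"
  obtain a r where r: "p = pCons a r" by (cases p)
  with p have "r \<noteq> 0" by (auto simp: monics_def)
  with p r have "r \<in> monics m" by (auto simp: monics_def)
  with r show "p \<in> (\<lambda>(a, p). pCons a p) ` (UNIV \<times> monics m)" by auto
qed (auto simp: monics_def)

lemma finite_monics: "finite (monics m :: 'a :: {field, finite} poly set)"
  and card_monics: "card (monics m :: 'a :: {field, finite} poly set) = CARD('a) ^ m"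
proof (induction m)
  case 0
  have "monics 0 = {1 :: 'a poly}"
    by (auto simp: monics_def elim!: degree_eq_zeroE)
  then show "finite (monics 0 :: 'a poly set)" "card (monics 0 :: 'a poly set) = CARD('a) ^ 0"
    by auto
next
  case (Suc m)
  have "inj_on (\<lambda>(a, p :: 'a poly). pCons a p) (UNIV \<times> monics m)"
    by (auto simp: inj_on_def)
  with Suc show "finite (monics (Suc m) :: 'a poly set)"
    "card (monics (Suc m) :: 'a poly set) = CARD('a) ^ Suc m"
    by (simp_all add: monics_Suc card_image card_cartesian_product)
qed

lemma finite_monics_degree_le:
  "finite {g :: 'a :: {field, finite} poly. lead_coeff g = 1 \<and> degree g \<le> D}"
proof -
  have "{g :: 'a poly. lead_coeff g = 1 \<and> degree g \<le> D} = (\<Union>m\<le>D. monics m)"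
    by (auto simp: monics_def)
  then show ?thesis by (simp add: finite_monics)
qed

definition smooth_monics :: "nat \<Rightarrow> 'a :: field poly set \<Rightarrow> 'a poly set" where
  "smooth_monics D T =
    {g. lead_coeff g = 1 \<and> degree g \<le> D \<and> (\<forall>f\<in>monic_irreducibles. f dvd g \<longrightarrow> f \<in> T)}"

lemma finite_smooth_monics: "finite (smooth_monics D (T :: 'a :: {field, finite} poly set))"
  by (rule finite_subset[OF _ finite_monics_degree_le[of D]]) (auto simp: smooth_monics_def)

lemma smooth_monics_empty: "smooth_monics D {} \<subseteq> {1}"
proof
  fix g :: "'a poly" assume g: "g \<in> smooth_monics D {}"
  then have "degree g = 0"
    using monic_irreducible_factor_exists[of g] by (fastforce simp: smooth_monics_def)
  with g show "g \<in> {1}" by (auto simp: smooth_monics_def elim!: degree_eq_zeroE)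
qed

lemma smooth_monics_insert:
  assumes f: "f \<in> monic_irreducibles"
  shows "smooth_monics D (insert f T) \<subseteq> (\<lambda>(j, h). f ^ j * h) ` ({..D} \<times> smooth_monics D T)"
proof
  fix g assume g: "g \<in> smooth_monics D (insert f T)"
  then have "g \<noteq> 0" "degree g \<le> D" by (auto simp: smooth_monics_def)
  from split_off_power_poly[OF monic_irreduciblesD(5)[OF f] \<open>g \<noteq> 0\<close>]
  obtain j h where h: "g = f ^ j * h" "\<not> f dvd h" .
  with \<open>g \<noteq> 0\<close> have "h \<noteq> 0" "f \<noteq> 0" by (auto simp: monic_irreduciblesD(3)[OF f])
  with h have "degree g = j * degree f + degree h"
    by (simp add: degree_mult_eq degree_power_eq)
  moreover have "j \<le> j * degree f" using monic_irreduciblesD(5)[OF f] by simp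
  ultimately have "j \<le> D" "degree h \<le> D" using \<open>degree g \<le> D\<close> by linarith+
  moreover have "lead_coeff h = 1"
    using g h monic_irreduciblesD(2)[OF f]
    by (simp add: smooth_monics_def lead_coeff_mult lead_coeff_power)
  moreover have "e \<in> T" if "e \<in> monic_irreducibles" "e dvd h" for e
    using that g h by (auto simp: smooth_monics_def)
  ultimately show "g \<in> (\<lambda>(j, h). f ^ j * h) ` ({..D} \<times> smooth_monics D T)"
    using h(1) by (force simp: smooth_monics_def)
qed

lemma card_smooth_monics_le:
  fixes T :: "'a :: {field, finite} poly set"
  assumes "finite T" "T \<subseteq> monic_irreducibles"
  shows "card (smooth_monics D T) \<le> (D + 1) ^ card T"
  using assms
proof (induction T rule: finite_induct)
  case empty
  show ?case using card_mono[OF _ smooth_monics_empty[of D]] by simp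
next
  case (insert f T)
  have "card (smooth_monics D (insert f T)) \<le>
      card ((\<lambda>(j, h). f ^ j * h) ` ({..D} \<times> smooth_monics D T))"
    using insert.prems by (intro card_mono smooth_monics_insert) (auto simp: finite_smooth_monics)
  also have "\<dots> \<le> (D + 1) * card (smooth_monics D T)"
    using card_image_le[of "{..D} \<times> smooth_monics D T"]
    by (simp add: finite_smooth_monics card_cartesian_product)
  also have "\<dots> \<le> (D + 1) * (D + 1) ^ card T"
    using insert by (intro mult_left_mono) auto
  also have "\<dots> = (D + 1) ^ card (insert f T)"
    using insert by simp
  finally show ?case .
qed

lemma exponential_dominates_power: "\<exists>D :: nat. 2 * (D + 1) ^ k \<le> 2 ^ D"
proof -
  have "(\<lambda>D. 2 * (real D + 1) ^ k / 2 ^ D) \<longlonglongrightarrow> 0" by real_asymp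
  then have "\<forall>\<^sub>F D in sequentially. 2 * (real D + 1) ^ k / 2 ^ D < 1"
    by (rule order_tendstoD) simp
  then obtain D :: nat where "2 * (real D + 1) ^ k < 2 ^ D"
    by (auto simp: field_simps eventually_sequentially)
  then have "real (2 * (D + 1) ^ k) \<le> real (2 ^ D)" by (simp add: add.commute)
  then show ?thesis by (simp only: of_nat_le_iff) blast
qed

definition reciprocal_norm :: "'a :: {field, finite} poly \<Rightarrow> real" where
  "reciprocal_norm f = 1 / real CARD('a) ^ degree f"

lemma reciprocal_norm_pos: "reciprocal_norm f > 0"
  by (simp add: reciprocal_norm_def)

lemma monics_subset_smooth_Un_multiples:
  "monics D \<subseteq> smooth_monics D T \<union>
    (\<Union>f\<in>{f \<in> monic_irreducibles. degree f \<le> D} - T. (\<lambda>h. f * h) ` monics (D - degree f))"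
proof
  fix g :: "'a poly" assume g: "g \<in> monics D"
  show "g \<in> smooth_monics D T \<union>
    (\<Union>f\<in>{f \<in> monic_irreducibles. degree f \<le> D} - T. (\<lambda>h. f * h) ` monics (D - degree f))"
  proof (cases "g \<in> smooth_monics D T")
    case False
    then obtain f where f: "f \<in> monic_irreducibles" "f dvd g" "f \<notin> T"
      using g by (auto simp: smooth_monics_def monics_def)
    then obtain h where h: "g = f * h" by blast
    have "g \<noteq> 0" using g by (auto simp: monics_def)
    with h have "f \<noteq> 0" "h \<noteq> 0" by auto
    with h have "degree g = degree f + degree h" by (simp add: degree_mult_eq)
    moreover have "lead_coeff h = 1"
      using h g monic_irreduciblesD(2)[OF f(1)] by (simp add: lead_coeff_mult monics_def)
    ultimately have "degree f \<le> D" "h \<in> monics (D - degree f)"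
      using g by (auto simp: monics_def)
    with f h show ?thesis by blast
  qed simp
qed

text \<open>
  Erdos' proof of the divergence of \<open>\<Sum> 1 / p\<close>: the polynomials all of whose irreducible factors lie
  in \<open>T\<close> are too few, so the multiples of the other irreducible polynomials cover half of the monic
  polynomials of some degree \<open>D\<close>.
\<close>

lemma irreducibles_mass_ge_half:
  fixes T :: "'a :: {field, finite} poly set"
  assumes "finite T" "T \<subseteq> monic_irreducibles"
  obtains U where "finite U" "U \<subseteq> monic_irreducibles" "U \<inter> T = {}"
    "1 / 2 \<le> (\<Sum>f\<in>U. reciprocal_norm f)"
proof -
  let ?q = "CARD('a)"
  obtain D where "2 * (D + 1) ^ card T \<le> 2 ^ D" using exponential_dominates_power by blast
  also have "\<dots> \<le> ?q ^ D" using two_le_CARD by (intro power_mono) auto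
  finally have few_smooth: "2 * (D + 1) ^ card T \<le> ?q ^ D" .
  define U where "U = {f \<in> monic_irreducibles. degree f \<le> D} - T"
  have "finite U"
    by (rule finite_subset[OF _ finite_monics_degree_le[of D]])
      (auto simp: U_def dest: monic_irreduciblesD)
  have "?q ^ D = card (monics D :: 'a poly set)"
    by (simp add: card_monics)
  also have "\<dots> \<le> card (smooth_monics D T \<union> (\<Union>f\<in>U. (\<lambda>h. f * h) ` monics (D - degree f)))"
    unfolding U_def using \<open>finite U\<close>
    by (intro card_mono monics_subset_smooth_Un_multiples)
      (auto simp: U_def finite_smooth_monics finite_monics)
  also have "\<dots> \<le> card (smooth_monics D T) + (\<Sum>f\<in>U. card ((\<lambda>h. f * h) ` monics (D - degree f)))"
    using \<open>finite U\<close> by (intro order.trans[OF card_Un_le] add_left_mono card_UN_le)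
  also have "\<dots> \<le> (D + 1) ^ card T + (\<Sum>f\<in>U. ?q ^ (D - degree f))"
    using assms by (intro add_mono sum_mono card_smooth_monics_le)
      (simp_all add: card_monics[symmetric] card_image_le finite_monics)
  finally have "?q ^ D \<le> 2 * (\<Sum>f\<in>U. ?q ^ (D - degree f))" using few_smooth by linarith
  then have "real ?q ^ D \<le> 2 * (\<Sum>f\<in>U. real ?q ^ (D - degree f))"
    by (simp flip: of_nat_power of_nat_sum of_nat_mult)
  also have "\<dots> = real ?q ^ D * (2 * (\<Sum>f\<in>U. reciprocal_norm f))"
    by (simp add: U_def reciprocal_norm_def power_diff sum_distrib_left mult_ac)
  finally have "1 / 2 \<le> (\<Sum>f\<in>U. reciprocal_norm f)" by simp
  with \<open>finite U\<close> show thesis by (intro that[of U]) (auto simp: U_def)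
qed

lemma irreducibles_mass_unbounded:
  fixes T :: "'a :: {field, finite} poly set" and L :: real
  assumes T: "finite T" "T \<subseteq> monic_irreducibles"
  obtains U where "finite U" "U \<subseteq> monic_irreducibles" "U \<inter> T = {}"
    "L \<le> (\<Sum>f\<in>U. reciprocal_norm f)"
proof -
  obtain m where m: "2 * L \<le> real m" using real_arch_simple by blast
  have "\<exists>U. finite U \<and> U \<subseteq> monic_irreducibles \<and> U \<inter> T = {} \<and>
    real m / 2 \<le> (\<Sum>f\<in>U. reciprocal_norm f)"
  proof (induction m)
    case 0
    show ?case by (intro exI[of _ "{}"]) auto
  next
    case (Suc m)
    then obtain U where U: "finite U" "U \<subseteq> monic_irreducibles" "U \<inter> T = {}"
      "real m / 2 \<le> (\<Sum>f\<in>U. reciprocal_norm f)" by blast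
    obtain U' where U': "finite U'" "U' \<subseteq> monic_irreducibles" "U' \<inter> (T \<union> U) = {}"
      "1 / 2 \<le> (\<Sum>f\<in>U'. reciprocal_norm f)"
      using irreducibles_mass_ge_half[of "T \<union> U"] T U by auto
    have "real (Suc m) / 2 \<le> (\<Sum>f\<in>U. reciprocal_norm f) + (\<Sum>f\<in>U'. reciprocal_norm f)"
      using U(4) U'(4) by (simp add: field_simps)
    also have "\<dots> = (\<Sum>f\<in>U \<union> U'. reciprocal_norm f)"
      using U U' by (intro sum.union_disjoint[symmetric]) auto
    finally show ?case using U U' by (intro exI[of _ "U \<union> U'"]) auto
  qed
  then obtain U where U: "finite U" "U \<subseteq> monic_irreducibles" "U \<inter> T = {}"
    and "real m / 2 \<le> (\<Sum>f\<in>U. reciprocal_norm f)" by blast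
  moreover from this m have "L \<le> (\<Sum>f\<in>U. reciprocal_norm f)" by linarith
  ultimately show thesis using that by blast
qed

lemma disjoint_irreducible_families:
  fixes T :: "'a :: {field, finite} poly set" and L :: real and K :: nat
  assumes T: "finite T" "T \<subseteq> monic_irreducibles"
  obtains \<F> where "disjoint_family_on \<F> {..<K}"
    "\<And>i. i < K \<Longrightarrow> finite (\<F> i)" "\<And>i. i < K \<Longrightarrow> \<F> i \<subseteq> monic_irreducibles - T"
    "\<And>i. i < K \<Longrightarrow> L \<le> (\<Sum>f\<in>\<F> i. reciprocal_norm f)"
proof -
  have "\<exists>\<F>. disjoint_family_on \<F> {..<K} \<and> (\<forall>i<K. finite (\<F> i) \<and>
    \<F> i \<subseteq> monic_irreducibles - T \<and> L \<le> (\<Sum>f\<in>\<F> i. reciprocal_norm f))"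
  proof (induction K)
    case 0
    show ?case by (simp add: disjoint_family_on_def)
  next
    case (Suc K)
    then obtain \<F> where \<F>: "disjoint_family_on \<F> {..<K}"
      "\<forall>i<K. finite (\<F> i) \<and> \<F> i \<subseteq> monic_irreducibles - T \<and> L \<le> (\<Sum>f\<in>\<F> i. reciprocal_norm f)"
      by blast
    have "finite (T \<union> (\<Union>i<K. \<F> i))" "T \<union> (\<Union>i<K. \<F> i) \<subseteq> monic_irreducibles"
      using \<F>(2) T by auto
    then obtain U where U: "finite U" "U \<subseteq> monic_irreducibles" "U \<inter> (T \<union> (\<Union>i<K. \<F> i)) = {}"
      "L \<le> (\<Sum>f\<in>U. reciprocal_norm f)"
      by (rule irreducibles_mass_unbounded)
    have "disjoint_family_on (\<F>(K := U)) {..<Suc K}"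
      using \<F>(1) U(3) by (fastforce simp: disjoint_family_on_def less_Suc_eq)
    moreover have "\<forall>i<Suc K. finite ((\<F>(K := U)) i) \<and> (\<F>(K := U)) i \<subseteq> monic_irreducibles - T \<and>
        L \<le> (\<Sum>f\<in>(\<F>(K := U)) i. reciprocal_norm f)"
      using \<F>(2) U by (auto simp: less_Suc_eq)
    ultimately show ?case by blast
  qed
  with that show thesis by blast
qed

section \<open>Transitive group actions\<close>

lemma (in group) group_actionI:
  assumes closed: "\<And>g x. g \<in> carrier G \<Longrightarrow> x \<in> E \<Longrightarrow> act g x \<in> E"
    and one: "\<And>x. x \<in> E \<Longrightarrow> act \<one> x = x"
    and mult: "\<And>g h x. g \<in> carrier G \<Longrightarrow> h \<in> carrier G \<Longrightarrow> x \<in> E \<Longrightarrow>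
      act (g \<otimes> h) x = act g (act h x)"
  shows "group_action G E (\<lambda>g. \<lambda>x\<in>E. act g x)"
proof -
  have inverse: "act (inv g) (act g x) = x" "act g (act (inv g) x) = x"
    if "g \<in> carrier G" "x \<in> E" for g x
    using that mult[of "inv g" g x] mult[of g "inv g" x] one by simp_all
  have Bij: "(\<lambda>x\<in>E. act g x) \<in> Bij E" if "g \<in> carrier G" for g
  proof -
    have "bij_betw (\<lambda>x\<in>E. act g x) E E"
      using that closed inverse by (intro bij_betwI[where g = "act (inv g)"]) auto
    then show ?thesis by (simp add: Bij_def)
  qed
  have "(\<lambda>g. \<lambda>x\<in>E. act g x) \<in> hom G (BijGroup E)"
    using Bij closed mult
    by (intro homI) (auto simp: BijGroup_def compose_def fun_eq_iff)
  then show ?thesis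
    by (intro group_action.intro group_hom.intro group_hom_axioms.intro group_BijGroup)
      unfold_locales
qed

lemma (in transitive_action) card_transporter:
  assumes x: "x \<in> E" and y: "y \<in> E"
  shows "card E * card {g \<in> carrier G. \<phi> g x = y} = order G"
proof -
  interpret group G using group_hom by (rule group_hom.axioms)
  have "orbit G \<phi> x = E"
    using unique_orbit[OF x] element_image[OF _ x] by (fastforce simp: orbit_def)
  moreover obtain a where a: "a \<in> carrier G" "\<phi> a x = y" using unique_orbit x y by blast
  have "bij_betw (\<lambda>g. a \<otimes> g) (stabilizer G \<phi> x) {g \<in> carrier G. \<phi> g x = y}"
  proof (rule bij_betwI[where g = "\<lambda>g. inv a \<otimes> g"])
    show "(\<lambda>g. a \<otimes> g) \<in> stabilizer G \<phi> x \<rightarrow> {g \<in> carrier G. \<phi> g x = y}"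
      using a composition_rule[OF x] by (auto simp: stabilizer_def)
    have "\<phi> (inv a) y = x" using orbit_sym_aux[OF a(1) x a(2)] .
    then show "(\<lambda>g. inv a \<otimes> g) \<in> {g \<in> carrier G. \<phi> g x = y} \<rightarrow> stabilizer G \<phi> x"
      using a composition_rule[OF x] by (auto simp: stabilizer_def)
  qed (use a in \<open>auto simp: stabilizer_def m_assoc[symmetric]\<close>)
  then have "card (stabilizer G \<phi> x) = card {g \<in> carrier G. \<phi> g x = y}"
    by (rule bij_betw_same_card)
  ultimately show ?thesis using orbit_stabilizer_theorem[OF x] by simp
qed

section \<open>Injective matrices\<close>

lemma mult_mat_zero_vec [simp]:
  "A \<in> carrier_mat n k \<Longrightarrow> A *\<^sub>v 0\<^sub>v k = (0\<^sub>v n :: 'a :: semiring_0 vec)"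
  by (intro eq_vecI) auto

lemma zero_mat_mult_vec [simp]:
  "v \<in> carrier_vec k \<Longrightarrow> 0\<^sub>m n k *\<^sub>v v = (0\<^sub>v n :: 'a :: semiring_0 vec)"
  by (intro eq_vecI) auto

lemma carrier_vec_append_cases:
  assumes "z \<in> carrier_vec (k + l)"
  obtains x y where "x \<in> carrier_vec k" "y \<in> carrier_vec l" "z = x @\<^sub>v y"
  using that[of "vec_first z k" "vec_last z l"] assms by simp

lemma eq_mat_by_vec:
  fixes V W :: "'a :: semiring_1 mat"
  assumes V: "V \<in> carrier_mat n k" and W: "W \<in> carrier_mat n k"
    and eq: "\<And>x. x \<in> carrier_vec k \<Longrightarrow> V *\<^sub>v x = W *\<^sub>v x"
  shows "V = W"
proof (rule mat_col_eqI)
  fix j assume "j < dim_col W"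
  then have j: "j < k" using W by simp
  have "V *\<^sub>v unit_vec k j = W *\<^sub>v unit_vec k j" by (rule eq) simp
  then show "col V j = col W j"
    using col_mult2[OF V one_carrier_mat j] col_mult2[OF W one_carrier_mat j] V W j by simp
qed (use V W in auto)

lemma finite_carrier_mat: "finite (carrier_mat n k :: 'a :: finite mat set)"
proof -
  have "carrier_mat n k \<subseteq> mat n k ` (PiE ({..<n} \<times> {..<k}) (\<lambda>_. UNIV :: 'a set))"
  proof
    fix A :: "'a mat" assume "A \<in> carrier_mat n k"
    then have "A = mat n k (restrict (\<lambda>ij. A $$ ij) ({..<n} \<times> {..<k}))"
      by (intro eq_matI) auto
    moreover have "restrict (\<lambda>ij. A $$ ij) ({..<n} \<times> {..<k}) \<in> PiE ({..<n} \<times> {..<k}) (\<lambda>_. UNIV)"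
      by auto
    ultimately show "A \<in> mat n k ` (PiE ({..<n} \<times> {..<k}) (\<lambda>_. UNIV))"
      by blast
  qed
  then show ?thesis by (rule finite_subset) (intro finite_imageI finite_PiE, auto)
qed

definition inj_mats :: "nat \<Rightarrow> nat \<Rightarrow> 'a :: field mat set" where
  "inj_mats n k = {V \<in> carrier_mat n k. \<forall>x\<in>carrier_vec k. V *\<^sub>v x = 0\<^sub>v n \<longrightarrow> x = 0\<^sub>v k}"

lemma inj_matsD:
  assumes "V \<in> inj_mats n k"
  shows "V \<in> carrier_mat n k" "x \<in> carrier_vec k \<Longrightarrow> V *\<^sub>v x = 0\<^sub>v n \<Longrightarrow> x = 0\<^sub>v k"
  using assms by (auto simp: inj_mats_def)

lemma finite_inj_mats: "finite (inj_mats n k :: 'a :: {field, finite} mat set)"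
  by (rule finite_subset[OF _ finite_carrier_mat[of n k]]) (auto simp: inj_mats_def)

lemma inj_mats_mult:
  assumes A: "A \<in> inj_mats n k" and B: "B \<in> inj_mats k l"
  shows "A * B \<in> inj_mats n l"
proof -
  note carrier = inj_matsD(1)[OF A] inj_matsD(1)[OF B]
  have "x = 0\<^sub>v l" if x: "x \<in> carrier_vec l" "(A * B) *\<^sub>v x = 0\<^sub>v n" for x
  proof -
    have "A *\<^sub>v (B *\<^sub>v x) = 0\<^sub>v n" using x carrier by simp
    then have "B *\<^sub>v x = 0\<^sub>v k" using carrier x by (intro inj_matsD(2)[OF A]) auto
    then show ?thesis using x by (intro inj_matsD(2)[OF B])
  qed
  then show ?thesis using carrier by (auto simp: inj_mats_def)
qed

lemma inj_mats_square_iff: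
  "(A :: 'a :: field mat) \<in> inj_mats n n \<longleftrightarrow> A \<in> carrier_mat n n \<and> det A \<noteq> 0"
  using det_0_iff_vec_prod_zero_field[of A n] by (auto simp: inj_mats_def)

definition append_cols :: "'a :: zero mat \<Rightarrow> 'a mat \<Rightarrow> 'a mat" (infixr \<open>@\<^sub>c\<close> 65) where
  "V @\<^sub>c W = four_block_mat V W (0\<^sub>m 0 (dim_col V)) (0\<^sub>m 0 (dim_col W))"

lemma append_cols_carrier [simp]:
  "V \<in> carrier_mat n k \<Longrightarrow> W \<in> carrier_mat n l \<Longrightarrow> V @\<^sub>c W \<in> carrier_mat n (k + l)"
  by (auto simp: append_cols_def)

lemma append_cols_index:
  assumes "V \<in> carrier_mat n k" "W \<in> carrier_mat n l" "i < n" "j < k + l"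
  shows "(V @\<^sub>c W) $$ (i, j) = (if j < k then V $$ (i, j) else W $$ (i, j - k))"
  using assms by (simp add: append_cols_def)

lemma append_cols_mult_vec:
  assumes V: "V \<in> carrier_mat n k" and W: "W \<in> carrier_mat n l"
    and x: "x \<in> carrier_vec k" and y: "y \<in> carrier_vec l"
  shows "(V @\<^sub>c W) *\<^sub>v (x @\<^sub>v y) = V *\<^sub>v x + W *\<^sub>v (y :: 'a :: comm_ring_1 vec)"
proof -
  have "(V @\<^sub>c W) *\<^sub>v (x @\<^sub>v y) =
      (V *\<^sub>v x + W *\<^sub>v y) @\<^sub>v (0\<^sub>m 0 k *\<^sub>v x + 0\<^sub>m 0 l *\<^sub>v y)"
    unfolding append_cols_def carrier_matD(2)[OF V] carrier_matD(2)[OF W]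
    using assms by (intro four_block_mat_mult_vec) auto
  also have "\<dots> = V *\<^sub>v x + W *\<^sub>v y"
    using assms by (intro eq_vecI) auto
  finally show ?thesis .
qed

lemma append_cols_eqD:
  assumes carrier: "V \<in> carrier_mat n k" "W \<in> carrier_mat n l"
      "V' \<in> carrier_mat n k" "W' \<in> carrier_mat n l"
    and eq: "V @\<^sub>c W = V' @\<^sub>c W'"
  shows "V = V'" "W = W'"
proof -
  have entry: "(V @\<^sub>c W) $$ (i, j) = (V' @\<^sub>c W') $$ (i, j)" for i j using eq by simp
  show "V = V'"
  proof (rule eq_matI)
    fix i j assume "i < dim_row V'" "j < dim_col V'"
    then show "V $$ (i, j) = V' $$ (i, j)"
      using entry[of i j] carrier by (simp add: append_cols_index[of _ n k _ l])
  qed (use carrier in auto)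
  show "W = W'"
  proof (rule eq_matI)
    fix i j assume "i < dim_row W'" "j < dim_col W'"
    then show "W $$ (i, j) = W' $$ (i, j)"
      using entry[of i "k + j"] carrier by (simp add: append_cols_index[of _ n k _ l])
  qed (use carrier in auto)
qed

lemma append_cols_inj_mats:
  assumes V: "V \<in> inj_mats n k" and W: "W \<in> inj_mats n l"
    and disjoint: "\<And>x y. x \<in> carrier_vec k \<Longrightarrow> y \<in> carrier_vec l \<Longrightarrow> V *\<^sub>v x = W *\<^sub>v y \<Longrightarrow> x = 0\<^sub>v k"
  shows "V @\<^sub>c W \<in> inj_mats n (k + l)"
proof -
  note carrier = inj_matsD(1)[OF V] inj_matsD(1)[OF W]
  have "z = 0\<^sub>v (k + l)" if z: "z \<in> carrier_vec (k + l)" "(V @\<^sub>c W) *\<^sub>v z = 0\<^sub>v n" for z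
  proof -
    obtain x y where xy: "x \<in> carrier_vec k" "y \<in> carrier_vec l" "z = x @\<^sub>v y"
      using carrier_vec_append_cases[OF z(1)] .
    then have sum: "V *\<^sub>v x + W *\<^sub>v y = 0\<^sub>v n"
      using z(2) append_cols_mult_vec[OF carrier xy(1,2)] by simp
    have "V *\<^sub>v x = W *\<^sub>v (- y)"
    proof (rule eq_vecI)
      fix i assume "i < dim_vec (W *\<^sub>v (- y))"
      then have "i < n" using carrier by simp
      then have "(V *\<^sub>v x + W *\<^sub>v y) $ i = 0" using sum by simp
      then show "(V *\<^sub>v x) $ i = (W *\<^sub>v (- y)) $ i"
        using \<open>i < n\<close> carrier xy by (simp add: eq_neg_iff_add_eq_0)
    qed (use carrier in auto)
    then have "x = 0\<^sub>v k" using xy by (intro disjoint[of x "- y"]) auto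
    moreover from this have "y = 0\<^sub>v l"
      using sum carrier xy by (intro inj_matsD(2)[OF W]) auto
    ultimately show ?thesis using xy(3) by auto
  qed
  then show ?thesis using carrier by (auto simp: inj_mats_def)
qed

lemma mult_append_cols:
  fixes B :: "'a :: comm_ring_1 mat"
  assumes B: "B \<in> carrier_mat m n" and V: "V \<in> carrier_mat n k" and W: "W \<in> carrier_mat n l"
  shows "B * (V @\<^sub>c W) = B * V @\<^sub>c B * W"
proof (rule eq_mat_by_vec)
  fix z :: "'a vec" assume z: "z \<in> carrier_vec (k + l)"
  obtain x y where xy: "x \<in> carrier_vec k" "y \<in> carrier_vec l" "z = x @\<^sub>v y"
    using carrier_vec_append_cases[OF z] .
  have "(B * (V @\<^sub>c W)) *\<^sub>v z = B *\<^sub>v (V *\<^sub>v x + W *\<^sub>v y)"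
    using assoc_mult_mat_vec[OF B append_cols_carrier[OF V W] z]
      append_cols_mult_vec[OF V W xy(1,2)] xy(3) by simp
  also have "\<dots> = B *\<^sub>v (V *\<^sub>v x) + B *\<^sub>v (W *\<^sub>v y)"
    using B V W xy by (intro mult_add_distrib_mat_vec) auto
  also have "\<dots> = (B * V @\<^sub>c B * W) *\<^sub>v z"
    using append_cols_mult_vec[OF mult_carrier_mat[OF B V] mult_carrier_mat[OF B W] xy(1,2)]
      B V W xy by simp
  finally show "(B * (V @\<^sub>c W)) *\<^sub>v z = (B * V @\<^sub>c B * W) *\<^sub>v z" .
qed (use mult_carrier_mat[OF B append_cols_carrier[OF V W]]
  append_cols_carrier[OF mult_carrier_mat[OF B V] mult_carrier_mat[OF B W]] in auto)

abbreviation block_diag :: "'a :: zero mat \<Rightarrow> 'a mat \<Rightarrow> 'a mat" where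
  "block_diag C D \<equiv>
    four_block_mat C (0\<^sub>m (dim_row C) (dim_col D)) (0\<^sub>m (dim_row D) (dim_col C)) D"

lemma append_cols_mult_block_diag:
  fixes V W :: "'a :: comm_ring_1 mat"
  assumes "V \<in> carrier_mat n k" "W \<in> carrier_mat n l" "C \<in> carrier_mat k k" "D \<in> carrier_mat l l"
  shows "(V @\<^sub>c W) * block_diag C D = V * C @\<^sub>c W * D"
proof -
  have "(V @\<^sub>c W) * block_diag C D = four_block_mat (V * C + W * 0\<^sub>m l k) (V * 0\<^sub>m k l + W * D)
      (0\<^sub>m 0 k * C + 0\<^sub>m 0 l * 0\<^sub>m l k) (0\<^sub>m 0 k * 0\<^sub>m k l + 0\<^sub>m 0 l * D)"
    unfolding append_cols_def using assms
    by (subst mult_four_block_mat[of _ n k _ l _ 0 _ _ k _ l]) auto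
  also have "\<dots> = V * C @\<^sub>c W * D"
    using assms by (simp add: append_cols_def)
  finally show ?thesis .
qed

lemma block_diag_inj_mats:
  assumes "C \<in> inj_mats k k" "D \<in> inj_mats l l"
  shows "block_diag C D \<in> inj_mats (k + l) (k + l)"
proof -
  have "C \<in> carrier_mat k k" "D \<in> carrier_mat l l" "det C \<noteq> 0" "det D \<noteq> 0"
    using assms by (auto simp: inj_mats_square_iff)
  then show ?thesis
    using det_four_block_mat_lower_left_zero[of C k "0\<^sub>m k l" l "0\<^sub>m l k" D]
    by (auto simp: inj_mats_square_iff)
qed

section \<open>Transitivity of the special linear group on injective matrices\<close>

lemma inj_mats_not_surj:
  fixes V :: "'a :: field mat"
  assumes V: "V \<in> carrier_mat n k" and "k < n"
  obtains v where "v \<in> carrier_vec n" "\<And>x. x \<in> carrier_vec k \<Longrightarrow> V *\<^sub>v x \<noteq> v"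
proof -
  define A where "A = mat n n (\<lambda>(i, j). if j < k then V $$ (i, j) else 0)"
  have A: "A \<in> carrier_mat n n" "transpose_mat A \<in> carrier_mat n n" by (simp_all add: A_def)
  have "A *\<^sub>v unit_vec n k = 0\<^sub>v n"
    using \<open>k < n\<close> by (intro eq_vecI) (auto simp: A_def)
  then have "det A = 0"
    using det_0_iff_vec_prod_zero_field[OF A(1)] unit_vec_nonzero[OF \<open>k < n\<close>] unit_vec_carrier
    by blast
  then have "det (transpose_mat A) = 0" by (simp add: det_transpose[OF A(1)])
  then obtain w where w: "w \<in> carrier_vec n" "w \<noteq> 0\<^sub>v n" "transpose_mat A *\<^sub>v w = 0\<^sub>v n"
    using det_0_iff_vec_prod_zero_field[OF A(2)] by blast
  have orthogonal: "transpose_mat V *\<^sub>v w = 0\<^sub>v k"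
  proof (rule eq_vecI)
    fix j assume "j < dim_vec (0\<^sub>v k :: 'a vec)"
    then have j: "j < k" "j < n" using \<open>k < n\<close> by auto
    then have "col A j = col V j" using V by (intro eq_vecI) (auto simp: A_def)
    moreover have "(transpose_mat A *\<^sub>v w) $ j = 0" using w(3) j by simp
    ultimately show "(transpose_mat V *\<^sub>v w) $ j = 0\<^sub>v k $ j" using V A j by simp
  qed (use V in auto)
  obtain i where i: "i < n" "w $ i \<noteq> 0"
    using w(1,2) by (metis carrier_vecD eq_vecI index_zero_vec)
  have "V *\<^sub>v x \<noteq> unit_vec n i" if x: "x \<in> carrier_vec k" for x
  proof
    assume "V *\<^sub>v x = unit_vec n i"
    then have "w $ i = w \<bullet> (V *\<^sub>v x)" using w(1) i(1) by simp
    also have "\<dots> = 0"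
      using transpose_vec_mult_scalar[OF V x w(1)] x by (simp add: orthogonal)
    finally show False using i(2) by simp
  qed
  then show thesis by (intro that[of "unit_vec n i"]) auto
qed

lemma inj_mats_append_col:
  assumes V: "V \<in> inj_mats n k" and v: "v \<in> carrier_vec n"
    and not_range: "\<And>x. x \<in> carrier_vec k \<Longrightarrow> V *\<^sub>v x \<noteq> v"
  shows "V @\<^sub>c mat_of_cols n [v] \<in> inj_mats n (k + 1)"
proof -
  let ?W = "mat_of_cols n [v]"
  note V_carrier = inj_matsD(1)[OF V]
  have W: "?W *\<^sub>v y = y $ 0 \<cdot>\<^sub>v v" if "y \<in> carrier_vec 1" for y
    using that v by (intro eq_vecI) (auto simp: scalar_prod_def mat_of_cols_def)
  have coeff_zero: "y $ 0 = 0"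
    if x: "x \<in> carrier_vec k" and y: "y \<in> carrier_vec 1" and eq: "V *\<^sub>v x = ?W *\<^sub>v y" for x y
  proof (rule ccontr)
    assume "y $ 0 \<noteq> 0"
    have "V *\<^sub>v (inverse (y $ 0) \<cdot>\<^sub>v x) = inverse (y $ 0) \<cdot>\<^sub>v (V *\<^sub>v x)"
      using V_carrier x by (rule mult_mat_vec)
    also have "\<dots> = v" using \<open>y $ 0 \<noteq> 0\<close> v by (simp add: eq W[OF y] smult_smult_assoc)
    finally show False using not_range x by simp
  qed
  have "y = 0\<^sub>v 1" if y: "y \<in> carrier_vec 1" "?W *\<^sub>v y = 0\<^sub>v n" for y
  proof -
    have "y $ 0 = 0" using y V_carrier by (intro coeff_zero[of "0\<^sub>v k"]) auto
    with y(1) show ?thesis by (intro eq_vecI) auto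
  qed
  then have "?W \<in> inj_mats n 1" by (auto simp: inj_mats_def)
  moreover have "x = 0\<^sub>v k"
    if "x \<in> carrier_vec k" "y \<in> carrier_vec 1" "V *\<^sub>v x = ?W *\<^sub>v y" for x y
    using that coeff_zero[OF that] v by (intro inj_matsD(2)[OF V]) (auto simp: W)
  ultimately show ?thesis using V by (intro append_cols_inj_mats)
qed

definition identity_cols :: "nat \<Rightarrow> nat \<Rightarrow> 'a :: zero_neq_one mat" where
  "identity_cols n k = mat n k (\<lambda>(i, j). if i = j then 1 else 0)"

lemma identity_cols_carrier [simp]: "identity_cols n k \<in> carrier_mat n k"
  by (simp add: identity_cols_def)

lemma identity_cols_inj_mats:
  assumes "k \<le> n"
  shows "identity_cols n k \<in> inj_mats n k"
proof -
  have "x = 0\<^sub>v k" if x: "x \<in> carrier_vec k" "identity_cols n k *\<^sub>v x = 0\<^sub>v n" for x :: "'a vec"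
  proof (rule eq_vecI)
    fix i assume "i < dim_vec (0\<^sub>v k :: 'a vec)"
    then have i: "i < k" "i < n" using assms by auto
    then have "row (identity_cols n k) i = (unit_vec k i :: 'a vec)"
      by (intro eq_vecI) (auto simp: identity_cols_def)
    then have "(identity_cols n k *\<^sub>v x) $ i = x $ i"
      using i x(1) by (simp add: identity_cols_def)
    then show "x $ i = 0\<^sub>v k $ i" using i x(2) by simp
  qed (use x in auto)
  then show ?thesis by (simp add: inj_mats_def)
qed

lemma mult_identity_cols_eq_iff:
  fixes A :: "'a :: field mat"
  assumes A: "A \<in> carrier_mat n n" and V: "V \<in> carrier_mat n k" and "k \<le> n"
  shows "A * identity_cols n k = V \<longleftrightarrow> (\<forall>i<n. \<forall>j<k. A $$ (i, j) = V $$ (i, j))"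
proof -
  have "(A * identity_cols n k) $$ (i, j) = A $$ (i, j)" if "i < n" "j < k" for i j
  proof -
    have "col (identity_cols n k) j = (unit_vec n j :: 'a vec)"
      using that \<open>k \<le> n\<close> by (intro eq_vecI) (auto simp: identity_cols_def)
    then show ?thesis using that A \<open>k \<le> n\<close> by (simp add: identity_cols_def)
  qed
  moreover have "A * identity_cols n k \<in> carrier_mat n k" using A by simp
  ultimately show ?thesis using V by (auto simp: mat_eq_iff)
qed

lemma inj_mats_complete:
  fixes V :: "'a :: field mat"
  assumes "V \<in> inj_mats n k" "k \<le> n"
  obtains A where "A \<in> inj_mats n n" "A * identity_cols n k = V"
proof -
  have "\<exists>A\<in>inj_mats n n. A * identity_cols n k = V"
    using assms
  proof (induction "n - k" arbitrary: k V)
    case 0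
    then have "k = n" "identity_cols n n = (1\<^sub>m n :: 'a mat)"
      by (auto simp: identity_cols_def)
    with 0 show ?case using inj_matsD(1) right_mult_one_mat by metis
  next
    case (Suc m)
    then have "k < n" by simp
    have V: "V \<in> carrier_mat n k" using Suc.prems(1) by (rule inj_matsD)
    obtain v where v: "v \<in> carrier_vec n" "\<And>x. x \<in> carrier_vec k \<Longrightarrow> V *\<^sub>v x \<noteq> v"
      using inj_mats_not_surj[OF V \<open>k < n\<close>] by blast
    define W where "W = V @\<^sub>c mat_of_cols n [v]"
    have "W \<in> inj_mats n (k + 1)"
      unfolding W_def by (rule inj_mats_append_col[OF Suc.prems(1) v])
    with Suc.hyps \<open>k < n\<close> obtain A
      where A: "A \<in> inj_mats n n" "A * identity_cols n (k + 1) = W" by force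
    have "A $$ (i, j) = V $$ (i, j)" if "i < n" "j < k" for i j
    proof -
      have "A $$ (i, j) = W $$ (i, j)"
        using A(2) mult_identity_cols_eq_iff[OF inj_matsD(1)[OF A(1)], of W "k + 1"] that
          \<open>W \<in> inj_mats n (k + 1)\<close> \<open>k < n\<close> by (auto dest: inj_matsD(1))
      then show ?thesis
        using that append_cols_index[OF V mat_of_cols_carrier(1)] by (simp add: W_def)
    qed
    then have "A * identity_cols n k = V"
      using mult_identity_cols_eq_iff[OF inj_matsD(1)[OF A(1)] V] \<open>k < n\<close> by simp
    with A(1) show ?case ..
  qed
  with that show thesis by blast
qed

lemma carrier_SL_iff: "A \<in> carrier (SL n) \<longleftrightarrow> A \<in> carrier_mat n n \<and> det A = 1"
  by (simp add: SL_def)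

lemma mult_SL: "A \<otimes>\<^bsub>SL n\<^esub> B = A * B"
  by (simp add: SL_def)

lemma one_SL: "\<one>\<^bsub>SL n\<^esub> = 1\<^sub>m n"
  by (simp add: SL_def)

lemma carrier_SL_carrier_mat: "A \<in> carrier (SL n) \<Longrightarrow> A \<in> carrier_mat n n"
  by (simp add: carrier_SL_iff)

lemma carrier_SL_inj_mats: "A \<in> carrier (SL n) \<Longrightarrow> A \<in> inj_mats n n"
  by (simp add: inj_mats_square_iff carrier_SL_iff)

lemma finite_carrier_SL: "finite (carrier (SL n :: 'a :: {field, finite} mat monoid))"
  by (rule finite_subset[OF _ finite_carrier_mat[of n n]]) (auto simp: carrier_SL_iff)

interpretation SL: group "SL n :: 'a :: field mat monoid" for n
  by (rule group_SL)

lemma SL_completes_inj_mats: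
  fixes V :: "'a :: field mat"
  assumes V: "V \<in> inj_mats n k" and "k < n"
  obtains P where "P \<in> carrier (SL n)" "P * identity_cols n k = V"
proof -
  obtain A where A: "A \<in> inj_mats n n" "A * identity_cols n k = V"
    using inj_mats_complete[OF V] \<open>k < n\<close> by auto
  then have A_carrier: "A \<in> carrier_mat n n" and "det A \<noteq> 0"
    by (auto simp: inj_mats_square_iff)
  define P where "P = multcol (n - 1) (inverse (det A)) A"
  have P_carrier: "P \<in> carrier_mat n n" using A_carrier by (auto simp: P_def)
  have "det P = det A * inverse (det A)"
    unfolding P_def multcol_mat[OF A_carrier] using \<open>k < n\<close>
    by (subst det_mult[OF A_carrier]) (auto simp: det_multrow_mat)
  then have "P \<in> carrier (SL n)"
    using P_carrier \<open>det A \<noteq> 0\<close> by (simp add: carrier_SL_iff)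
  moreover have "P * identity_cols n k = V"
    using A(2) A_carrier \<open>k < n\<close>
      mult_identity_cols_eq_iff[OF A_carrier inj_matsD(1)[OF V]]
      mult_identity_cols_eq_iff[OF P_carrier inj_matsD(1)[OF V]]
    by (auto simp: P_def)
  ultimately show thesis by (rule that)
qed

lemma SL_transitive_action:
  assumes "k < n"
  shows "transitive_action (SL n) (inj_mats n k :: 'a :: field mat set)
    (\<lambda>A. \<lambda>V\<in>inj_mats n k. A * V)"
proof (intro transitive_action.intro transitive_action_axioms.intro)
  show "group_action (SL n) (inj_mats n k :: 'a mat set) (\<lambda>A. \<lambda>V\<in>inj_mats n k. A * V)"
  proof (rule SL.group_actionI)
    fix A B V :: "'a mat"
    assume "A \<in> carrier (SL n)" "B \<in> carrier (SL n)" "V \<in> inj_mats n k"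
    then show "(A \<otimes>\<^bsub>SL n\<^esub> B) * V = A * (B * V)"
      by (simp add: mult_SL carrier_SL_iff inj_mats_def assoc_mult_mat[of _ n n _ n _ k])
  qed (auto simp: one_SL dest: inj_matsD(1) intro: inj_mats_mult carrier_SL_inj_mats)
next
  fix V W :: "'a mat"
  let ?J = "identity_cols n k :: 'a mat"
  assume V: "V \<in> inj_mats n k" and "W \<in> inj_mats n k"
  then obtain P Q where P: "P \<in> carrier (SL n)" "P * ?J = V"
    and Q: "Q \<in> carrier (SL n)" "Q * ?J = W"
    using SL_completes_inj_mats[OF _ assms] by metis
  define P' where "P' = inv\<^bsub>SL n\<^esub> P"
  have P': "P' \<in> carrier (SL n)" "P' * P = 1\<^sub>m n"
    using P(1) SL.l_inv[of P n] by (simp_all add: P'_def mult_SL one_SL)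
  note carrier = P(1)[THEN carrier_SL_carrier_mat] Q(1)[THEN carrier_SL_carrier_mat]
    P'(1)[THEN carrier_SL_carrier_mat]
  have "(Q * P') * V = Q * (P' * V)"
    by (rule assoc_mult_mat[OF carrier(2,3) inj_matsD(1)[OF V]])
  also have "P' * V = (P' * P) * ?J"
    unfolding P(2)[symmetric]
    by (rule assoc_mult_mat[OF carrier(3,1) identity_cols_carrier, symmetric])
  also have "Q * ((P' * P) * ?J) = W"
    by (simp add: P'(2) Q(2) left_mult_one_mat[OF identity_cols_carrier])
  finally show "\<exists>A\<in>carrier (SL n). (\<lambda>V\<in>inj_mats n k. A * V) V = W"
    using V SL.m_closed[OF Q(1) P'(1)] by (auto simp: mult_SL)
qed

definition intertwiners :: "'a :: field mat \<Rightarrow> 'a mat \<Rightarrow> 'a mat set" where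
  "intertwiners B C = {V \<in> inj_mats (dim_row B) (dim_row C). B * V = V * C}"

lemma finite_intertwiners: "finite (intertwiners (B :: 'a :: {field, finite} mat) C)"
  by (rule finite_subset[OF _ finite_inj_mats]) (auto simp: intertwiners_def)

text \<open>
  For a fixed \<open>V\<close>, the matrices \<open>B \<in> SL n\<close> with \<open>B * V = V * C\<close> carry \<open>V\<close> to another injective
  matrix, so by transitivity their number does not depend on \<open>V\<close>.
\<close>

lemma sum_card_intertwiners:
  fixes C :: "'a :: {field, finite} mat"
  assumes C: "C \<in> inj_mats k k" and "k < n"
  shows "(\<Sum>B\<in>carrier (SL n). card (intertwiners B C)) = order (SL n :: 'a mat monoid)"
proof -
  let ?I = "inj_mats n k :: 'a mat set" and ?G = "carrier (SL n :: 'a mat monoid)"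
  interpret transitive_action "SL n" ?I "\<lambda>A. \<lambda>V\<in>?I. A * V"
    using \<open>k < n\<close> by (rule SL_transitive_action)
  have transporter: "card ?I * card {B \<in> ?G. B * V = V * C} = order (SL n :: 'a mat monoid)"
    if V: "V \<in> ?I" for V
    using card_transporter[OF V inj_mats_mult[OF V C]] V by simp
  have "(\<Sum>B\<in>?G. card (intertwiners B C)) = (\<Sum>B\<in>?G. card {V \<in> ?I. B * V = V * C})"
    using inj_matsD(1)[OF C] by (intro sum.cong refl) (auto simp: intertwiners_def carrier_SL_iff)
  also have "\<dots> = (\<Sum>V\<in>?I. card {B \<in> ?G. B * V = V * C})"
    using finite_inj_mats finite_carrier_SL by (intro sum_multicount_gen) auto
  finally have
    "card ?I * (\<Sum>B\<in>?G. card (intertwiners B C)) = card ?I * order (SL n :: 'a mat monoid)"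
    by (simp add: sum_distrib_left transporter)
  moreover have "card ?I \<noteq> 0"
    using identity_cols_inj_mats[of k n, where 'a = 'a] \<open>k < n\<close> finite_inj_mats
    by (metis card_eq_0_iff empty_iff less_imp_le)
  ultimately show ?thesis by simp
qed

section \<open>Polynomials in a matrix\<close>

definition mat_poly :: "'a :: field mat \<Rightarrow> 'a poly \<Rightarrow> 'a mat" where
  "mat_poly B p =
    fold_coeffs (\<lambda>a A. a \<cdot>\<^sub>m 1\<^sub>m (dim_row B) + B * A) p (0\<^sub>m (dim_row B) (dim_row B))"

locale square_matrix =
  fixes n :: nat and B :: "'a :: field mat"
  assumes B_carrier [simp]: "B \<in> carrier_mat n n"
begin

lemma dim_B [simp]: "dim_row B = n" "dim_col B = n"
  using carrier_matD[OF B_carrier] by auto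

lemma mat_poly_0 [simp]: "mat_poly B 0 = 0\<^sub>m n n"
  by (simp add: mat_poly_def)

lemma mat_poly_pCons: "mat_poly B (pCons a p) = a \<cdot>\<^sub>m 1\<^sub>m n + B * mat_poly B p"
proof (cases "a = 0 \<and> p = 0")
  case True
  have "0 \<cdot>\<^sub>m 1\<^sub>m n + B * 0\<^sub>m n n = 0\<^sub>m n n" by (intro eq_matI) auto
  with True show ?thesis by simp
next
  case False
  then show ?thesis
    by (cases "a = 0")
      (auto simp: mat_poly_def fold_coeffs_pCons_coeff_not_0_eq fold_coeffs_pCons_not_0_0_eq)
qed

lemma mat_poly_carrier [simp]: "mat_poly B p \<in> carrier_mat n n"
  by (induction p) (auto simp: mat_poly_pCons)

lemma dim_mat_poly [simp]: "dim_row (mat_poly B p) = n" "dim_col (mat_poly B p) = n"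
  using carrier_matD[OF mat_poly_carrier] by auto

lemma mat_poly_add: "mat_poly B (p + r) = mat_poly B p + mat_poly B r"
proof (induction p r rule: poly_induct2)
  case (pCons a p b r)
  have "B * (mat_poly B p + mat_poly B r) = B * mat_poly B p + B * mat_poly B r"
    by (intro mult_add_distrib_mat[of _ n n _ n]) auto
  then show ?case
    by (simp add: mat_poly_pCons pCons) (intro eq_matI, auto simp: algebra_simps)
qed simp

lemma mat_poly_smult: "mat_poly B (Polynomial.smult c p) = c \<cdot>\<^sub>m mat_poly B p"
proof (induction p)
  case (pCons a p)
  have "B * (c \<cdot>\<^sub>m mat_poly B p) = c \<cdot>\<^sub>m (B * mat_poly B p)"
    by (intro mult_smult_distrib[of _ n n _ n]) auto
  then show ?case
    by (simp add: mat_poly_pCons pCons) (intro eq_matI, auto simp: algebra_simps)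
qed auto

lemma mat_poly_mult: "mat_poly B (p * r) = mat_poly B p * mat_poly B r"
proof (induction p)
  case 0
  show ?case using left_mult_zero_mat[OF mat_poly_carrier] by simp
next
  case (pCons a p)
  let ?P = "mat_poly B p" and ?R = "mat_poly B r"
  have "mat_poly B (pCons a p * r) = a \<cdot>\<^sub>m ?R + (0 \<cdot>\<^sub>m 1\<^sub>m n + B * (?P * ?R))"
    by (simp add: mat_poly_add mat_poly_smult mat_poly_pCons pCons)
  also have "0 \<cdot>\<^sub>m 1\<^sub>m n + B * (?P * ?R) = B * (?P * ?R)"
    by (intro eq_matI) auto
  also have "a \<cdot>\<^sub>m ?R + B * (?P * ?R) = (a \<cdot>\<^sub>m 1\<^sub>m n) * ?R + B * ?P * ?R"
    using mat_poly_carrier[of p] mat_poly_carrier[of r]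
    by (simp add: mult_smult_assoc_mat[of _ n n _ n] assoc_mult_mat[of _ n n _ n _ n])
  also have "\<dots> = (a \<cdot>\<^sub>m 1\<^sub>m n + B * ?P) * ?R"
    by (intro add_mult_distrib_mat[symmetric, of _ n n _ _ n]) auto
  finally show ?case by (simp add: mat_poly_pCons)
qed

lemma mat_poly_1 [simp]: "mat_poly B 1 = 1\<^sub>m n"
  by (simp add: one_pCons mat_poly_pCons) (intro eq_matI, auto)

lemma mat_poly_X [simp]: "mat_poly B [:0, 1:] = B"
  by (simp add: mat_poly_pCons) (intro eq_matI, auto)

lemma mat_poly_power: "mat_poly B (p ^ j) = mat_poly B p ^\<^sub>m j"
proof (induction j)
  case (Suc j)
  have "p ^ Suc j = p ^ j * p" by simp
  then show ?case by (simp only: mat_poly_mult Suc pow_mat.simps)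
qed simp

lemma det_mat_poly_mult: "det (mat_poly B (p * r)) = det (mat_poly B p) * det (mat_poly B r)"
  unfolding mat_poly_mult by (rule det_mult[of _ n]) auto

lemma mat_poly_vec_carrier [simp]: "v \<in> carrier_vec n \<Longrightarrow> mat_poly B p *\<^sub>v v \<in> carrier_vec n"
  by (rule mult_mat_vec_carrier) auto

lemma mat_poly_mult_vec:
  "v \<in> carrier_vec n \<Longrightarrow> mat_poly B (p * r) *\<^sub>v v = mat_poly B p *\<^sub>v (mat_poly B r *\<^sub>v v)"
  unfolding mat_poly_mult by (rule assoc_mult_mat_vec[of _ n n _ n]) auto

lemma mat_poly_add_vec:
  "v \<in> carrier_vec n \<Longrightarrow> mat_poly B (p + r) *\<^sub>v v = mat_poly B p *\<^sub>v v + mat_poly B r *\<^sub>v v"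
  unfolding mat_poly_add by (rule add_mult_distrib_mat_vec[of _ n n]) auto

lemma mat_poly_smult_vec:
  "v \<in> carrier_vec n \<Longrightarrow> mat_poly B (Polynomial.smult c p) *\<^sub>v v = c \<cdot>\<^sub>v (mat_poly B p *\<^sub>v v)"
  by (intro eq_vecI) (auto simp: mat_poly_smult row_smult)

lemma mat_poly_pCons_vec:
  assumes v: "v \<in> carrier_vec n"
  shows "mat_poly B (pCons a p) *\<^sub>v v = a \<cdot>\<^sub>v v + B *\<^sub>v (mat_poly B p *\<^sub>v v)"
proof -
  have "mat_poly B (pCons a p) *\<^sub>v v = (a \<cdot>\<^sub>m 1\<^sub>m n) *\<^sub>v v + (B * mat_poly B p) *\<^sub>v v"
    unfolding mat_poly_pCons using v by (intro add_mult_distrib_mat_vec[of _ n n]) auto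
  also have "(a \<cdot>\<^sub>m 1\<^sub>m n) *\<^sub>v v = a \<cdot>\<^sub>v v"
    using v by (intro eq_vecI) (auto simp: row_smult)
  also have "(B * mat_poly B p) *\<^sub>v v = B *\<^sub>v (mat_poly B p *\<^sub>v v)"
    using v by (intro assoc_mult_mat_vec[of _ n n _ n]) auto
  finally show ?thesis .
qed

lemma mat_poly_dvd_vec:
  assumes v: "v \<in> carrier_vec n" and f: "mat_poly B f *\<^sub>v v = 0\<^sub>v n" and "f dvd p"
  shows "mat_poly B p *\<^sub>v v = 0\<^sub>v n"
proof -
  obtain k where "p = k * f" using \<open>f dvd p\<close> by (auto simp: dvd_def mult.commute)
  then show ?thesis
    using v f mult_mat_zero_vec[OF mat_poly_carrier] by (simp add: mat_poly_mult_vec)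
qed

lemma mat_poly_coprime_vec:
  assumes v: "v \<in> carrier_vec n" and "coprime a b"
    and a: "mat_poly B a *\<^sub>v v = 0\<^sub>v n" and b: "mat_poly B b *\<^sub>v v = 0\<^sub>v n"
  shows "v = 0\<^sub>v n"
proof -
  obtain u w where "u * a + w * b = 1" using bezout_poly[OF \<open>coprime a b\<close>] .
  then have "v = mat_poly B (u * a + w * b) *\<^sub>v v" using v by simp
  also have "\<dots> = 0\<^sub>v n"
    using v mat_poly_dvd_vec[OF v a, of "u * a"] mat_poly_dvd_vec[OF v b, of "w * b"]
    by (simp add: mat_poly_add_vec)
  finally show ?thesis .
qed

lemma mat_poly_intertwine:
  assumes V: "V \<in> carrier_mat n k" and C: "C \<in> carrier_mat k k"
    and eq: "B * V = V * C" and x: "x \<in> carrier_vec k"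
  shows "mat_poly B p *\<^sub>v (V *\<^sub>v x) = V *\<^sub>v (mat_poly C p *\<^sub>v x)"
proof -
  interpret C: square_matrix k C by unfold_locales (rule C)
  have Vx: "V *\<^sub>v x \<in> carrier_vec n" using V x by simp
  show ?thesis
  proof (induction p)
    case 0
    show ?case using V x Vx by simp
  next
    case (pCons a p)
    define y where "y = mat_poly C p *\<^sub>v x"
    have y: "y \<in> carrier_vec k" using x by (simp add: y_def)
    have B_V: "B *\<^sub>v (V *\<^sub>v y) = V *\<^sub>v (C *\<^sub>v y)"
      using assoc_mult_mat_vec[OF B_carrier V y] assoc_mult_mat_vec[OF V C y] by (simp add: eq)
    have "V *\<^sub>v (a \<cdot>\<^sub>v x + C *\<^sub>v y) = V *\<^sub>v (a \<cdot>\<^sub>v x) + V *\<^sub>v (C *\<^sub>v y)"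
      using x by (intro mult_add_distrib_mat_vec[OF V] mult_mat_vec_carrier[OF C y]) auto
    also have "V *\<^sub>v (a \<cdot>\<^sub>v x) = a \<cdot>\<^sub>v (V *\<^sub>v x)" using V x by (rule mult_mat_vec)
    finally show ?case
      using B_V pCons
      by (simp add: mat_poly_pCons_vec[OF Vx] C.mat_poly_pCons_vec[OF x] y_def[symmetric])
  qed
qed

end

definition has_annihilator :: "'a :: field mat \<Rightarrow> 'a vec \<Rightarrow> 'a poly \<Rightarrow> bool" where
  "has_annihilator B v f \<longleftrightarrow> v \<in> carrier_vec (dim_row B) \<and>
    (\<forall>p. mat_poly B p *\<^sub>v v = 0\<^sub>v (dim_row B) \<longleftrightarrow> f dvd p)"

context square_matrix
begin

lemma has_annihilatorD:
  assumes "has_annihilator B v f"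
  shows "v \<in> carrier_vec n" "mat_poly B p *\<^sub>v v = 0\<^sub>v n \<longleftrightarrow> f dvd p"
  using assms by (auto simp: has_annihilator_def)

lemma has_annihilator_nonzero:
  assumes "has_annihilator B v f" "\<not> is_unit f"
  shows "v \<noteq> 0\<^sub>v n"
  using has_annihilatorD(1)[OF assms(1)] has_annihilatorD(2)[OF assms(1), of 1] assms(2) by auto

text \<open>
  Schur's lemma for the cyclic modules \<open>F[x]/(f)\<close> and \<open>F[x]/(g)\<close> generated by \<open>v\<close> and \<open>w\<close>: if they
  intersect nontrivially, they coincide.
\<close>

lemma has_annihilator_irreducible_eq:
  assumes v: "has_annihilator B v f" and w: "has_annihilator B w g"
    and f: "f \<in> monic_irreducibles" and g: "g \<in> monic_irreducibles"
    and eq: "mat_poly B p *\<^sub>v v = mat_poly B r *\<^sub>v w" and "\<not> f dvd p"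
  shows "f = g"
proof -
  note carrier = has_annihilatorD(1)[OF v] has_annihilatorD(1)[OF w]
  have "mat_poly B (g * p) *\<^sub>v v = mat_poly B (g * r) *\<^sub>v w"
    using carrier by (simp add: mat_poly_mult_vec eq)
  also have "\<dots> = 0\<^sub>v n" using has_annihilatorD(2)[OF w] by simp
  finally have "f dvd g * p" using has_annihilatorD(2)[OF v] by simp
  with f \<open>\<not> f dvd p\<close> have "f dvd g" by (simp add: monic_irreducible_dvd_mult_iff)
  with f g show "f = g" by (rule monic_irreducibles_dvd_imp_eq)
qed

lemma has_annihilator_irreducible_multiple:
  assumes v: "has_annihilator B v f" and w: "has_annihilator B w f" and f: "f \<in> monic_irreducibles"
    and eq: "mat_poly B p *\<^sub>v v = mat_poly B r *\<^sub>v w" and "\<not> f dvd p"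
  obtains s where "w = mat_poly B s *\<^sub>v v"
proof -
  note carrier = has_annihilatorD(1)[OF v] has_annihilatorD(1)[OF w]
  have "\<not> f dvd r"
    using \<open>\<not> f dvd p\<close> has_annihilatorD(2)[OF v, of p] has_annihilatorD(2)[OF w, of r] eq by simp
  then obtain u t where bezout: "t * f + u * r = 1"
    using bezout_poly[OF coprime_monic_irreducible[OF f]] by blast
  have "w = mat_poly B (t * f + u * r) *\<^sub>v w" using carrier by (simp add: bezout)
  also have "\<dots> = mat_poly B (t * f) *\<^sub>v w + mat_poly B u *\<^sub>v (mat_poly B r *\<^sub>v w)"
    using carrier by (simp add: mat_poly_add_vec mat_poly_mult_vec[symmetric])
  also have "mat_poly B (t * f) *\<^sub>v w = 0\<^sub>v n" by (simp add: has_annihilatorD(2)[OF w])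
  also have "0\<^sub>v n + mat_poly B u *\<^sub>v (mat_poly B r *\<^sub>v w) = mat_poly B (u * p) *\<^sub>v v"
    using carrier by (simp add: mat_poly_mult_vec eq[symmetric])
  finally show thesis by (rule that)
qed

lemma range_mat_poly_vec_eq:
  assumes v: "v \<in> carrier_vec n"
    and f: "mat_poly B f *\<^sub>v v = 0\<^sub>v n" "degree f > 0" "lead_coeff f = 1"
  shows "range (\<lambda>p. mat_poly B p *\<^sub>v v) = (\<lambda>p. mat_poly B p *\<^sub>v v) ` monics (degree f)"
proof (intro equalityI image_subsetI)
  fix p :: "'a poly"
  have "f \<noteq> 0" using f(2) by auto
  then have small: "degree (p mod f) < degree f"
    using degree_mod_less[of f p] f(2) by auto
  have "p mod f + f \<in> monics (degree f)"
    using small f(3) by (simp add: monics_def degree_add_eq_right coeff_eq_0)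
  moreover have "mat_poly B p *\<^sub>v v = mat_poly B (p mod f + f) *\<^sub>v v"
  proof -
    have "mat_poly B p *\<^sub>v v = mat_poly B (p div f * f) *\<^sub>v v + mat_poly B (p mod f) *\<^sub>v v"
      using mat_poly_add_vec[OF v, of "p div f * f" "p mod f"] by simp
    then show ?thesis
      using v f(1) mat_poly_dvd_vec[OF v f(1), of "p div f * f"] by (simp add: mat_poly_add_vec)
  qed
  ultimately show "mat_poly B p *\<^sub>v v \<in> (\<lambda>p. mat_poly B p *\<^sub>v v) ` monics (degree f)" by blast
qed auto

end

locale finite_square_matrix = square_matrix n B for n and B :: "'a :: {field, finite} mat"
begin

lemma finite_range_mat_poly: "finite (range (mat_poly B))"
  by (rule finite_subset[OF _ finite_carrier_mat[of n n]]) auto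

lemma card_range_mat_poly_vec_le:
  assumes v: "has_annihilator B v f" and f: "f \<in> monic_irreducibles"
  shows "card (range (\<lambda>p. mat_poly B p *\<^sub>v v)) \<le> CARD('a) ^ degree f"
proof -
  have "range (\<lambda>p. mat_poly B p *\<^sub>v v) = (\<lambda>p. mat_poly B p *\<^sub>v v) ` monics (degree f)"
    using has_annihilatorD[OF v] monic_irreduciblesD[OF f] by (intro range_mat_poly_vec_eq) auto
  then show ?thesis
    using card_image_le[OF finite_monics] by (metis card_monics)
qed

end

section \<open>Companion matrices\<close>

definition poly_vec :: "'a :: field poly \<Rightarrow> 'a poly \<Rightarrow> 'a vec" where
  "poly_vec f p = vec (degree f) (coeff (p mod f))"

definition companion :: "'a :: field poly \<Rightarrow> 'a mat" where
  "companion f = mat (degree f) (degree f) (\<lambda>(i, j). coeff (monom 1 (Suc j) mod f) i)"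

lemma companion_carrier [simp]: "companion f \<in> carrier_mat (degree f) (degree f)"
  by (simp add: companion_def)

lemma dim_companion [simp]: "dim_row (companion f) = degree f" "dim_col (companion f) = degree f"
  by (simp_all add: companion_def)

lemma poly_vec_carrier [simp]: "poly_vec f p \<in> carrier_vec (degree f)"
  by (simp add: poly_vec_def)

lemma poly_vec_add: "poly_vec f (p + r) = poly_vec f p + poly_vec f r"
  by (intro eq_vecI) (auto simp: poly_vec_def poly_mod_add_left)

lemma poly_vec_smult: "poly_vec f (Polynomial.smult c p) = c \<cdot>\<^sub>v poly_vec f p"
  by (intro eq_vecI) (auto simp: poly_vec_def mod_smult_left)

lemma mod_sum_poly: "(\<Sum>i\<in>A. g i) mod f = (\<Sum>i\<in>A. g i mod f)" for f :: "'a :: field poly"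
  by (induction A rule: infinite_finite_induct) (auto simp: poly_mod_add_left)

context
  fixes f :: "'a :: field poly"
  assumes degree_f: "degree f > 0"
begin

lemma poly_vec_eq_0_iff: "poly_vec f p = 0\<^sub>v (degree f) \<longleftrightarrow> f dvd p"
proof
  assume eq: "poly_vec f p = 0\<^sub>v (degree f)"
  have "coeff (p mod f) i = 0" for i
  proof (cases "i < degree f")
    case True
    then have "poly_vec f p $ i = 0" using eq by simp
    with True show ?thesis by (simp add: poly_vec_def)
  next
    case False
    have "f \<noteq> 0" using degree_f by auto
    with False show ?thesis using degree_mod_less[of f p] by (auto intro: coeff_eq_0)
  qed
  then have "p mod f = 0" by (simp add: poly_eq_iff)
  then show "f dvd p" by (simp add: mod_eq_0_iff_dvd)
next
  assume "f dvd p"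
  then show "poly_vec f p = 0\<^sub>v (degree f)" by (intro eq_vecI) (auto simp: poly_vec_def)
qed

lemma poly_vec_surj:
  assumes x: "x \<in> carrier_vec (degree f)"
  obtains p where "x = poly_vec f p"
proof -
  define p where "p = Poly (list_of_vec x)"
  have coeff_p: "coeff p i = (if i < degree f then x $ i else 0)" for i
    using x by (simp add: p_def coeff_Poly_eq nth_default_def list_of_vec_index)
  have "degree p < degree f"
  proof (cases "p = 0")
    case False
    then have "coeff p (degree p) \<noteq> 0" by simp
    then show ?thesis by (auto simp: coeff_p split: if_splits)
  qed (use degree_f in simp)
  then have "x = poly_vec f p"
    using x by (intro eq_vecI) (auto simp: poly_vec_def mod_poly_less coeff_p)
  then show thesis by (rule that)
qed

lemma companion_mult_poly_vec: "companion f *\<^sub>v poly_vec f p = poly_vec f (pCons 0 p)"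
proof -
  define r where "r = p mod f"
  have "f \<noteq> 0" using degree_f by auto
  then have "degree r \<le> degree f - 1" using degree_mod_less[of f p] degree_f by (auto simp: r_def)
  moreover have "{..degree f - 1} = {0..<degree f}" using degree_f by auto
  ultimately have r: "r = (\<Sum>j = 0..<degree f. monom (coeff r j) j)"
    using poly_as_sum_of_monoms'[of r "degree f - 1"] by simp
  have "pCons 0 p mod f = [:0, 1:] * p mod f" by simp
  also have "\<dots> = [:0, 1:] * r mod f" unfolding r_def by (simp only: mod_mult_right_eq)
  also have "[:0, 1:] * r = (\<Sum>j = 0..<degree f. monom (coeff r j) (Suc j))"
    by (subst r) (simp add: sum_distrib_left monom_Suc)
  also have "\<dots> mod f = (\<Sum>j = 0..<degree f. Polynomial.smult (coeff r j) (monom 1 (Suc j) mod f))"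
    unfolding mod_sum_poly
    by (intro sum.cong refl) (simp add: mod_smult_left[symmetric] smult_monom)
  finally have "pCons 0 p mod f = \<dots>" .
  then show ?thesis
    by (intro eq_vecI)
      (simp_all add: companion_def poly_vec_def scalar_prod_def coeff_sum r_def mult.commute)
qed

lemma mat_poly_companion: "mat_poly (companion f) p *\<^sub>v poly_vec f r = poly_vec f (p * r)"
proof -
  interpret square_matrix "degree f" "companion f" by unfold_locales simp
  show ?thesis
  proof (induction p)
    case 0
    show ?case using poly_vec_eq_0_iff[of 0] by simp
  next
    case (pCons a p)
    then show ?case
      by (simp add: mat_poly_pCons_vec companion_mult_poly_vec poly_vec_add poly_vec_smult)
  qed
qed

lemma companion_inj_mats:
  assumes "coprime f [:0, 1:]"
  shows "companion f \<in> inj_mats (degree f) (degree f)"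
proof -
  have "x = 0\<^sub>v (degree f)"
    if x: "x \<in> carrier_vec (degree f)" "companion f *\<^sub>v x = 0\<^sub>v (degree f)" for x
  proof -
    obtain p where p: "x = poly_vec f p" using poly_vec_surj[OF x(1)] .
    obtain u w where bezout: "u * f + w * [:0, 1:] = 1" using bezout_poly[OF assms] .
    have "f dvd [:0, 1:] * p"
      using x(2) by (simp add: p companion_mult_poly_vec poly_vec_eq_0_iff)
    then have "f dvd w * ([:0, 1:] * p) + u * p * f"
      by (rule dvd_add[OF dvd_mult dvd_triv_right])
    also have "w * ([:0, 1:] * p) + u * p * f = (u * f + w * [:0, 1:]) * p"
      by (simp only: algebra_simps)
    finally have "f dvd p" unfolding bezout by simp
    then show ?thesis by (simp add: p poly_vec_eq_0_iff)
  qed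
  then show ?thesis by (simp add: inj_mats_def)
qed

end

lemma companion_monic_irreducible_inj_mats:
  assumes "f \<in> monic_irreducibles" "f \<noteq> [:0, 1:]"
  shows "companion f \<in> inj_mats (degree f) (degree f)"
proof (rule companion_inj_mats)
  show "degree f > 0" using assms(1) by (rule monic_irreduciblesD)
  show "coprime f [:0, 1:]"
    using assms monic_irreducibles_dvd_imp_eq[OF assms(1) X_in_monic_irreducibles]
    by (intro coprime_monic_irreducible) auto
qed

definition embeddings :: "'a :: field mat \<Rightarrow> 'a poly \<Rightarrow> 'a mat set" where
  "embeddings B f = intertwiners B (companion f)"

lemma finite_embeddings: "finite (embeddings (B :: 'a :: {field, finite} mat) f)"
  by (simp add: embeddings_def finite_intertwiners)

context square_matrix
begin

lemma embeddingsD: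
  assumes "V \<in> embeddings B f"
  shows "V \<in> inj_mats n (degree f)" "V \<in> carrier_mat n (degree f)" "B * V = V * companion f"
  using assms by (auto simp: embeddings_def intertwiners_def inj_mats_def)

lemma embedding_mult_poly_vec:
  assumes V: "V \<in> embeddings B f" and "degree f > 0"
  shows "V *\<^sub>v poly_vec f p = mat_poly B p *\<^sub>v (V *\<^sub>v poly_vec f 1)"
  using mat_poly_intertwine[OF embeddingsD(2)[OF V] companion_carrier embeddingsD(3)[OF V]
      poly_vec_carrier, of p 1]
  by (simp add: mat_poly_companion[OF \<open>degree f > 0\<close>])

lemma embedding_has_annihilator:
  assumes V: "V \<in> embeddings B f" and degree_f: "degree f > 0"
  shows "has_annihilator B (V *\<^sub>v poly_vec f 1) f"
proof -
  have "mat_poly B p *\<^sub>v (V *\<^sub>v poly_vec f 1) = 0\<^sub>v n \<longleftrightarrow> f dvd p" for p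
  proof -
    have "V *\<^sub>v poly_vec f p = 0\<^sub>v n \<longleftrightarrow> poly_vec f p = 0\<^sub>v (degree f)"
      using inj_matsD(2)[OF embeddingsD(1)[OF V] poly_vec_carrier]
        mult_mat_zero_vec[OF embeddingsD(2)[OF V]] by metis
    then show ?thesis
      by (simp only: embedding_mult_poly_vec[OF V degree_f, of p] poly_vec_eq_0_iff[OF degree_f])
  qed
  then show ?thesis using embeddingsD(2)[OF V] by (simp add: has_annihilator_def)
qed

lemma embedding_generator_inj:
  assumes degree_f: "degree f > 0"
  shows "inj_on (\<lambda>V. V *\<^sub>v poly_vec f 1) (embeddings B f)"
proof (rule inj_onI)
  fix V W assume V: "V \<in> embeddings B f" and W: "W \<in> embeddings B f"
    and eq: "V *\<^sub>v poly_vec f 1 = W *\<^sub>v poly_vec f 1"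
  show "V = W"
  proof (rule eq_mat_by_vec[OF embeddingsD(2)[OF V] embeddingsD(2)[OF W]])
    fix x :: "'a vec" assume "x \<in> carrier_vec (degree f)"
    then obtain p where "x = poly_vec f p" by (rule poly_vec_surj[OF degree_f])
    then show "V *\<^sub>v x = W *\<^sub>v x"
      using embedding_mult_poly_vec[OF V degree_f, of p]
        embedding_mult_poly_vec[OF W degree_f, of p] by (simp only: eq)
  qed
qed

end

lemma sum_card_embeddings:
  fixes f :: "'a :: {field, finite} poly"
  assumes f: "f \<in> monic_irreducibles" "f \<noteq> [:0, 1:]" and "degree f < n"
  shows "(\<Sum>B\<in>carrier (SL n). card (embeddings B f)) = order (SL n :: 'a mat monoid)"
  unfolding embeddings_def
  by (rule sum_card_intertwiners[OF companion_monic_irreducible_inj_mats[OF f] \<open>degree f < n\<close>])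

section \<open>Second moments\<close>

context square_matrix
begin

lemma append_cols_intertwiners:
  assumes V: "V \<in> intertwiners B C" and W: "W \<in> intertwiners B D"
    and C: "C \<in> carrier_mat k k" and D: "D \<in> carrier_mat l l"
    and inj: "V @\<^sub>c W \<in> inj_mats n (k + l)"
  shows "V @\<^sub>c W \<in> intertwiners B (block_diag C D)"
proof -
  have carrier: "V \<in> carrier_mat n k" "W \<in> carrier_mat n l"
    and eq: "B * V = V * C" "B * W = W * D"
    using V W C D by (auto simp: intertwiners_def inj_mats_def)
  have "B * (V @\<^sub>c W) = (V @\<^sub>c W) * block_diag C D"
    by (simp only: mult_append_cols[OF B_carrier carrier] eq
        append_cols_mult_block_diag[OF carrier C D])
  with inj C D show ?thesis by (simp add: intertwiners_def)
qed

lemma dependent_embeddings: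
  assumes V: "V \<in> embeddings B f" and W: "W \<in> embeddings B g"
    and f: "f \<in> monic_irreducibles" and g: "g \<in> monic_irreducibles"
    and "V @\<^sub>c W \<notin> inj_mats n (degree f + degree g)"
  shows "f = g" "W *\<^sub>v poly_vec g 1 \<in> range (\<lambda>p. mat_poly B p *\<^sub>v (V *\<^sub>v poly_vec f 1))"
proof -
  note degrees = monic_irreduciblesD(5)[OF f] monic_irreduciblesD(5)[OF g]
  note v = embedding_has_annihilator[OF V degrees(1)]
  note w = embedding_has_annihilator[OF W degrees(2)]
  obtain x y where x: "x \<in> carrier_vec (degree f)" "x \<noteq> 0\<^sub>v (degree f)"
    and y: "y \<in> carrier_vec (degree g)" and eq: "V *\<^sub>v x = W *\<^sub>v y"
    using append_cols_inj_mats[OF embeddingsD(1)[OF V] embeddingsD(1)[OF W]] assms(5) by blast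
  obtain p where p: "x = poly_vec f p" using poly_vec_surj[OF degrees(1) x(1)] .
  obtain r where r: "y = poly_vec g r" using poly_vec_surj[OF degrees(2) y] .
  have not_dvd: "\<not> f dvd p" using x(2) by (simp add: p poly_vec_eq_0_iff[OF degrees(1)])
  have meet: "mat_poly B p *\<^sub>v (V *\<^sub>v poly_vec f 1) = mat_poly B r *\<^sub>v (W *\<^sub>v poly_vec g 1)"
    using eq embedding_mult_poly_vec[OF V degrees(1), of p]
      embedding_mult_poly_vec[OF W degrees(2), of r] by (simp only: p r)
  show "f = g" using has_annihilator_irreducible_eq[OF v w f g meet not_dvd] .
  then have "has_annihilator B (W *\<^sub>v poly_vec g 1) f" using w by simp
  then obtain s where "W *\<^sub>v poly_vec g 1 = mat_poly B s *\<^sub>v (V *\<^sub>v poly_vec f 1)"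
    by (rule has_annihilator_irreducible_multiple[OF v _ f meet not_dvd])
  then show "W *\<^sub>v poly_vec g 1 \<in> range (\<lambda>p. mat_poly B p *\<^sub>v (V *\<^sub>v poly_vec f 1))"
    by simp
qed

lemma append_cols_inj_on_embeddings:
  "inj_on (\<lambda>(V, W). V @\<^sub>c W) (embeddings B f \<times> embeddings B g)"
proof (rule inj_onI, clarify)
  fix V W V' W'
  assume "V \<in> embeddings B f" "W \<in> embeddings B g" "V' \<in> embeddings B f" "W' \<in> embeddings B g"
    and "V @\<^sub>c W = V' @\<^sub>c W'"
  then show "V = V' \<and> W = W'" using append_cols_eqD embeddingsD(2) by metis
qed

end

context finite_square_matrix
begin

lemma card_dependent_embeddings_le:
  assumes V: "V \<in> embeddings B f"
    and f: "f \<in> monic_irreducibles" and g: "g \<in> monic_irreducibles"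
  shows "card {W \<in> embeddings B g. V @\<^sub>c W \<notin> inj_mats n (degree f + degree g)} \<le>
    (if f = g then CARD('a) ^ degree f else 0)"
    (is "card ?D \<le> _")
proof (cases "f = g")
  case False
  then have "?D = {}" using dependent_embeddings(1)[OF V _ f g] by blast
  then show ?thesis by (simp only: card.empty le0)
next
  case True
  let ?R = "range (\<lambda>p. mat_poly B p *\<^sub>v (V *\<^sub>v poly_vec f 1))"
  note degree_f = monic_irreduciblesD(5)[OF f]
  have "finite ((\<lambda>A. A *\<^sub>v (V *\<^sub>v poly_vec f 1)) ` range (mat_poly B))"
    by (intro finite_imageI finite_range_mat_poly)
  then have "finite ?R" by (simp add: image_image)
  then have "card ?D \<le> card ?R"
  proof (rule card_inj_on_le[rotated 2])
    show "inj_on (\<lambda>W. W *\<^sub>v poly_vec f 1) ?D"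
      using embedding_generator_inj[OF degree_f] True by (auto intro: inj_on_subset)
    show "(\<lambda>W. W *\<^sub>v poly_vec f 1) ` ?D \<subseteq> ?R"
      using dependent_embeddings(2)[OF V _ f g] True by auto
  qed
  also have "\<dots> \<le> CARD('a) ^ degree f"
    using embedding_has_annihilator[OF V degree_f] f by (rule card_range_mat_poly_vec_le)
  finally show ?thesis using True by simp
qed

lemma card_embeddings_mult_le:
  assumes f: "f \<in> monic_irreducibles" and g: "g \<in> monic_irreducibles"
  shows "card (embeddings B f) * card (embeddings B g) \<le>
    card (intertwiners B (block_diag (companion f) (companion g))) +
    card (embeddings B f) * (if f = g then CARD('a) ^ degree f else 0)"
proof -
  let ?I = "intertwiners B (block_diag (companion f) (companion g))"
  let ?indep = "\<lambda>V W. V @\<^sub>c W \<in> inj_mats n (degree f + degree g)"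
  define P where "P = {(V, W) \<in> embeddings B f \<times> embeddings B g. ?indep V W}"
  define Q where "Q = (SIGMA V:embeddings B f. {W \<in> embeddings B g. \<not> ?indep V W})"
  have "card (embeddings B f) * card (embeddings B g) = card (P \<union> Q)"
    unfolding card_cartesian_product[symmetric] P_def Q_def by (rule arg_cong[of _ _ card]) auto
  also have "\<dots> \<le> card P + card Q" by (rule card_Un_le)
  also have "card P \<le> card ?I"
  proof (rule card_inj_on_le)
    show "inj_on (\<lambda>(V, W). V @\<^sub>c W) P"
      by (rule inj_on_subset[OF append_cols_inj_on_embeddings]) (auto simp: P_def)
    show "(\<lambda>(V, W). V @\<^sub>c W) ` P \<subseteq> ?I"
      using append_cols_intertwiners[OF _ _ companion_carrier companion_carrier]
      by (auto simp: P_def embeddings_def)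
  qed (rule finite_intertwiners)
  also have "card Q = (\<Sum>V\<in>embeddings B f. card {W \<in> embeddings B g. \<not> ?indep V W})"
    unfolding Q_def
    by (intro card_SigmaI)
      (auto intro: finite_embeddings finite_subset[OF _ finite_embeddings[of B g]])
  also have "\<dots> \<le> (\<Sum>V\<in>embeddings B f. if f = g then CARD('a) ^ degree f else 0)"
    using f g by (intro sum_mono card_dependent_embeddings_le)
  finally show ?thesis by simp
qed

end

lemma sum_card_embeddings_mult_le:
  fixes f :: "'a :: {field, finite} poly"
  assumes f: "f \<in> monic_irreducibles" "f \<noteq> [:0, 1:]"
    and g: "g \<in> monic_irreducibles" "g \<noteq> [:0, 1:]" and "degree f + degree g < n"
  shows "(\<Sum>B\<in>carrier (SL n). card (embeddings B f) * card (embeddings B g)) \<le>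
    order (SL n :: 'a mat monoid) * (1 + (if f = g then CARD('a) ^ degree f else 0))"
    (is "_ \<le> _ * (1 + ?d)")
proof -
  let ?G = "carrier (SL n :: 'a mat monoid)" and ?C = "block_diag (companion f) (companion g)"
  have "?C \<in> inj_mats (degree f + degree g) (degree f + degree g)"
    using f g by (intro block_diag_inj_mats companion_monic_irreducible_inj_mats)
  then have mean: "(\<Sum>B\<in>?G. card (intertwiners B ?C)) = order (SL n :: 'a mat monoid)"
    using \<open>degree f + degree g < n\<close> by (rule sum_card_intertwiners)
  have "(\<Sum>B\<in>?G. card (embeddings B f) * card (embeddings B g)) \<le>
    (\<Sum>B\<in>?G. card (intertwiners B ?C) + card (embeddings B f) * ?d)"
  proof (rule sum_mono)
    fix B assume "B \<in> ?G"
    then interpret finite_square_matrix n B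
      by unfold_locales (rule carrier_SL_carrier_mat)
    show "card (embeddings B f) * card (embeddings B g) \<le>
        card (intertwiners B ?C) + card (embeddings B f) * ?d"
      using f(1) g(1) by (rule card_embeddings_mult_le)
  qed
  also have "\<dots> = order (SL n :: 'a mat monoid) + (\<Sum>B\<in>?G. card (embeddings B f)) * ?d"
    by (simp only: sum.distrib sum_distrib_right mean)
  also have "\<dots> = order (SL n :: 'a mat monoid) * (1 + ?d)"
    using sum_card_embeddings[OF f, of n] \<open>degree f + degree g < n\<close> by (simp add: distrib_left)
  finally show ?thesis .
qed

lemma Chebyshev_card_zero_le:
  fixes X :: "'a \<Rightarrow> real" and m v :: real
  assumes "finite A" and mean: "(\<Sum>x\<in>A. X x) = m * card A"
    and second_moment: "(\<Sum>x\<in>A. (X x)\<^sup>2) \<le> (m\<^sup>2 + v) * card A"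
  shows "card {x \<in> A. X x = 0} * m\<^sup>2 \<le> v * card A"
proof -
  have "card {x \<in> A. X x = 0} * m\<^sup>2 = (\<Sum>x\<in>{x \<in> A. X x = 0}. (X x - m)\<^sup>2)" by simp
  also have "\<dots> \<le> (\<Sum>x\<in>A. (X x - m)\<^sup>2)"
    using \<open>finite A\<close> by (intro sum_mono2) auto
  also have "\<dots> = (\<Sum>x\<in>A. (X x)\<^sup>2 - 2 * m * X x + m\<^sup>2)"
    by (simp add: power2_eq_square algebra_simps)
  also have "\<dots> = (\<Sum>x\<in>A. (X x)\<^sup>2) - 2 * m * (\<Sum>x\<in>A. X x) + card A * m\<^sup>2"
    by (simp add: sum.distrib sum_subtractf sum_distrib_left)
  also have "\<dots> \<le> v * card A"
    using second_moment by (simp add: mean algebra_simps power2_eq_square)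
  finally show ?thesis .
qed

lemma card_all_zero_le:
  fixes X :: "'i \<Rightarrow> 'a \<Rightarrow> real" and w :: "'i \<Rightarrow> real"
  assumes "finite A" "finite I" and w: "\<And>i. i \<in> I \<Longrightarrow> w i > 0"
    and mean: "\<And>i. i \<in> I \<Longrightarrow> (\<Sum>x\<in>A. X i x) = card A"
    and covariance: "\<And>i j. i \<in> I \<Longrightarrow> j \<in> I \<Longrightarrow>
      (\<Sum>x\<in>A. X i x * X j x) \<le> card A * (1 + (if i = j then 1 / w i else 0))"
  shows "card {x \<in> A. \<forall>i\<in>I. X i x = 0} * (\<Sum>i\<in>I. w i) \<le> card A"
proof -
  define \<mu> where "\<mu> = (\<Sum>i\<in>I. w i)"
  define S where "S = (\<lambda>x. \<Sum>i\<in>I. w i * X i x)"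
  have "(\<Sum>x\<in>A. S x) = (\<Sum>i\<in>I. w i * (\<Sum>x\<in>A. X i x))"
    unfolding S_def sum_distrib_left by (rule sum.swap)
  also have "\<dots> = \<mu> * card A" by (simp add: mean \<mu>_def sum_distrib_right)
  finally have mean_S: "(\<Sum>x\<in>A. S x) = \<mu> * card A" .
  have "(\<Sum>x\<in>A. (S x)\<^sup>2) = (\<Sum>x\<in>A. \<Sum>i\<in>I. \<Sum>j\<in>I. w i * w j * (X i x * X j x))"
    unfolding S_def power2_eq_square sum_product by (simp add: mult_ac)
  also have "\<dots> = (\<Sum>i\<in>I. \<Sum>j\<in>I. w i * w j * (\<Sum>x\<in>A. X i x * X j x))"
    unfolding sum_distrib_left by (subst sum.swap, rule sum.cong[OF refl], rule sum.swap)
  also have "\<dots> \<le> (\<Sum>i\<in>I. \<Sum>j\<in>I. w i * w j * (card A * (1 + (if i = j then 1 / w i else 0))))"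
    using w by (intro sum_mono mult_left_mono covariance) (auto simp: less_imp_le)
  also have "\<dots> = (\<Sum>i\<in>I. \<Sum>j\<in>I. card A * (w i * w j) + (if i = j then card A * w i else 0))"
    using w by (intro sum.cong refl) (force simp: algebra_simps)
  also have "\<dots> = card A * (\<Sum>i\<in>I. \<Sum>j\<in>I. w i * w j) + card A * (\<Sum>i\<in>I. w i)"
    using \<open>finite I\<close> by (simp add: sum.distrib sum_distrib_left)
  also have "\<dots> = (\<mu>\<^sup>2 + \<mu>) * card A"
    unfolding \<mu>_def power2_eq_square sum_product by (simp only: algebra_simps)
  finally have "(\<Sum>x\<in>A. (S x)\<^sup>2) \<le> (\<mu>\<^sup>2 + \<mu>) * card A" .
  from Chebyshev_card_zero_le[OF \<open>finite A\<close> mean_S this]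
  have Chebyshev: "card {x \<in> A. S x = 0} * \<mu> * \<mu> \<le> card A * \<mu>"
    by (simp add: power2_eq_square mult_ac)
  have "card {x \<in> A. \<forall>i\<in>I. X i x = 0} \<le> card {x \<in> A. S x = 0}"
    using \<open>finite A\<close> by (intro card_mono) (auto simp: S_def)
  moreover have "card {x \<in> A. S x = 0} * \<mu> \<le> card A"
  proof (cases "\<mu> > 0")
    case True
    with Chebyshev show ?thesis by simp
  next
    case False
    then have "card {x \<in> A. S x = 0} * \<mu> \<le> 0" by (simp add: mult_nonneg_nonpos)
    then show ?thesis by linarith
  qed
  moreover have "\<mu> \<ge> 0" unfolding \<mu>_def using w by (intro sum_nonneg) (auto intro: less_imp_le)
  ultimately show ?thesis
    unfolding \<mu>_def by (meson mult_right_mono of_nat_le_iff order.trans)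
qed

lemma card_no_embedding_le:
  fixes T :: "'a :: {field, finite} poly set"
  assumes "finite T" and T: "T \<subseteq> monic_irreducibles - {[:0, 1:]}"
    and n: "\<And>f. f \<in> T \<Longrightarrow> 2 * degree f < n"
  shows "card {B \<in> carrier (SL n). \<forall>f\<in>T. embeddings B f = {}} * (\<Sum>f\<in>T. reciprocal_norm f) \<le>
    order (SL n :: 'a mat monoid)"
proof -
  let ?G = "carrier (SL n :: 'a mat monoid)"
  let ?X = "\<lambda>f B. real (card (embeddings B (f :: 'a poly)))"
  have "card {B \<in> ?G. \<forall>f\<in>T. ?X f B = 0} * (\<Sum>f\<in>T. reciprocal_norm f) \<le> card ?G"
  proof (rule card_all_zero_le[OF finite_carrier_SL \<open>finite T\<close> reciprocal_norm_pos])
    fix f assume f: "f \<in> T"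
    have "degree f < n" using n[OF f] by simp
    then have "(\<Sum>B\<in>?G. card (embeddings B f)) = card ?G"
      using f T by (subst sum_card_embeddings) (auto simp: order_def)
    then show "(\<Sum>B\<in>?G. ?X f B) = card ?G" by (simp flip: of_nat_sum)
    fix g assume g: "g \<in> T"
    have "degree f + degree g < n" using n[OF f] n[OF g] by linarith
    then have "(\<Sum>B\<in>?G. card (embeddings B f) * card (embeddings B g)) \<le>
        card ?G * (1 + (if f = g then CARD('a) ^ degree f else 0))"
      using f g T unfolding order_def[symmetric] by (intro sum_card_embeddings_mult_le) auto
    then have "real (\<Sum>B\<in>?G. card (embeddings B f) * card (embeddings B g)) \<le>
        real (card ?G * (1 + (if f = g then CARD('a) ^ degree f else 0)))"
      by (simp only: of_nat_le_iff)
    then show "(\<Sum>B\<in>?G. ?X f B * ?X g B) \<le>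
        card ?G * (1 + (if f = g then 1 / reciprocal_norm f else 0))"
      by (simp add: reciprocal_norm_def distrib_left split: if_splits)
  qed
  then show ?thesis by (simp add: finite_embeddings order_def)
qed

section \<open>Irreducible factors and the fibres of the power map\<close>

definition mat_poly_kernel :: "'a :: field mat \<Rightarrow> 'a poly \<Rightarrow> 'a vec set" where
  "mat_poly_kernel B f = {v \<in> carrier_vec (dim_row B). mat_poly B f *\<^sub>v v = 0\<^sub>v (dim_row B)}"

definition irreducible_factors :: "'a :: field mat \<Rightarrow> 'a poly set" where
  "irreducible_factors B =
    {f \<in> monic_irreducibles. \<exists>v\<in>mat_poly_kernel B f. v \<noteq> 0\<^sub>v (dim_row B)}"

context square_matrix
begin

lemma mat_poly_kernel_iff:
  "v \<in> mat_poly_kernel B f \<longleftrightarrow> v \<in> carrier_vec n \<and> mat_poly B f *\<^sub>v v = 0\<^sub>v n"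
  by (simp add: mat_poly_kernel_def)

lemma embedding_imp_irreducible_factor:
  assumes f: "f \<in> monic_irreducibles" and "embeddings B f \<noteq> {}"
  shows "f \<in> irreducible_factors B"
proof -
  obtain V where "V \<in> embeddings B f" using assms(2) by blast
  then have v: "has_annihilator B (V *\<^sub>v poly_vec f 1) f"
    using monic_irreduciblesD(5)[OF f] by (rule embedding_has_annihilator)
  then have "V *\<^sub>v poly_vec f 1 \<in> mat_poly_kernel B f"
    using has_annihilatorD(1)[OF v] has_annihilatorD(2)[OF v, of f]
    by (simp add: mat_poly_kernel_iff)
  moreover have "V *\<^sub>v poly_vec f 1 \<noteq> 0\<^sub>v n"
    using v monic_irreduciblesD(4)[OF f] by (rule has_annihilator_nonzero)
  ultimately show ?thesis using f by (auto simp: irreducible_factors_def)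
qed

lemma irreducible_factor_dvd_annihilator:
  assumes h: "mat_poly B h = 0\<^sub>m n n" and "f \<in> irreducible_factors B"
  shows "f dvd h"
proof (rule ccontr)
  assume "\<not> f dvd h"
  obtain v where f: "f \<in> monic_irreducibles"
    and v: "v \<in> carrier_vec n" "v \<noteq> 0\<^sub>v n" "mat_poly B f *\<^sub>v v = 0\<^sub>v n"
    using assms(2) by (auto simp: irreducible_factors_def mat_poly_kernel_iff)
  have "v = 0\<^sub>v n"
    using mat_poly_coprime_vec[OF v(1) coprime_monic_irreducible[OF f \<open>\<not> f dvd h\<close>] v(3)] v(1)
    by (simp add: h)
  with v(2) show False ..
qed

text \<open>
  If \<open>f * h = f ^ Suc j * b\<close> with \<open>b\<close> prime to \<open>f\<close> and \<open>u * f ^ Suc j + w * b = 1\<close>, then \<open>w * b\<close>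
  projects onto the \<open>f\<close>-primary component.
\<close>

lemma primary_projection:
  assumes h: "h \<noteq> 0" "mat_poly B h = 0\<^sub>m n n" and f: "f \<in> monic_irreducibles"
  obtains e where "mat_poly B (e * e) = mat_poly B e"
    "\<forall>v\<in>mat_poly_kernel B f. mat_poly B e *\<^sub>v v = v"
    "\<forall>g\<in>monic_irreducibles - {f}. \<forall>v\<in>mat_poly_kernel B g. mat_poly B e *\<^sub>v v = 0\<^sub>v n"
proof -
  obtain j b where jb: "h = f ^ j * b" "\<not> f dvd b"
    using split_off_power_poly[OF monic_irreduciblesD(5)[OF f] h(1)] .
  obtain u w where bezout: "u * f ^ Suc j + w * b = 1"
    using bezout_poly[OF coprime_monic_irreducible_power[OF f jb(2)]] .
  define e where "e = w * b"
  have "e = e * (u * f ^ Suc j + w * b)" by (simp only: bezout mult_1_right)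
  also have "\<dots> = e * e + h * (w * u * f)" by (simp add: e_def jb(1) algebra_simps)
  finally have "mat_poly B e = mat_poly B (e * e) + 0\<^sub>m n n * mat_poly B (w * u * f)"
    by (metis mat_poly_add mat_poly_mult h(2))
  then have idempotent: "mat_poly B (e * e) = mat_poly B e"
    using left_mult_zero_mat[OF mat_poly_carrier] right_add_zero_mat[OF mat_poly_carrier] by simp
  have identity: "mat_poly B e *\<^sub>v v = v"
    if v: "v \<in> carrier_vec n" "mat_poly B f *\<^sub>v v = 0\<^sub>v n" for v
  proof -
    have "mat_poly B (u * f ^ Suc j) *\<^sub>v v = 0\<^sub>v n" by (rule mat_poly_dvd_vec[OF v]) simp
    moreover have "v = mat_poly B (u * f ^ Suc j + e) *\<^sub>v v"
      by (simp only: e_def bezout mat_poly_1 one_mult_mat_vec[OF v(1)])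
    ultimately show ?thesis
      using v(1) by (simp add: mat_poly_add_vec del: power_Suc)
  qed
  have zero: "mat_poly B e *\<^sub>v v = 0\<^sub>v n"
    if g: "g \<in> monic_irreducibles" "g \<noteq> f"
      and v: "v \<in> carrier_vec n" "mat_poly B g *\<^sub>v v = 0\<^sub>v n" for g v
  proof -
    have "\<not> f dvd g" using monic_irreducibles_dvd_imp_eq[OF f g(1)] g(2) by blast
    then have "coprime (f ^ j) g" by (rule coprime_monic_irreducible_power[OF f])
    moreover have "mat_poly B (f ^ j) *\<^sub>v (mat_poly B b *\<^sub>v v) = 0\<^sub>v n"
      using mat_poly_mult_vec[OF v(1), of "f ^ j" b] v(1) h(2) by (simp add: jb(1))
    moreover have "mat_poly B g *\<^sub>v (mat_poly B b *\<^sub>v v) = 0\<^sub>v n"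
      using mat_poly_dvd_vec[OF v dvd_triv_left, of b] by (simp only: mat_poly_mult_vec[OF v(1)])
    ultimately have "mat_poly B b *\<^sub>v v = 0\<^sub>v n"
      by (rule mat_poly_coprime_vec[OF mat_poly_vec_carrier[OF v(1)]])
    then show ?thesis unfolding e_def by (rule mat_poly_dvd_vec[OF v(1)]) simp
  qed
  show thesis
    using idempotent identity zero by (intro that) (auto simp: mat_poly_kernel_iff)
qed

lemma mat_poly_idempotent_scaling_power:
  assumes e: "mat_poly B (e * e) = mat_poly B e"
  shows "mat_poly B ((1 + Polynomial.smult (l - 1) e) ^ j) =
    mat_poly B (1 + Polynomial.smult (l ^ j - 1) e)"
proof (induction j)
  case (Suc j)
  let ?z = "\<lambda>c. 1 + Polynomial.smult (c - 1) e"
  have expand: "(1 + Polynomial.smult a e) * (1 + Polynomial.smult b e) =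
    1 + (Polynomial.smult (a + b) e + Polynomial.smult (a * b) (e * e))" for a b
    by (simp add: algebra_simps smult_add_left)
  have coeff: "(l ^ j - 1) + (l - 1) + (l ^ j - 1) * (l - 1) = l ^ Suc j - 1"
    by (simp add: algebra_simps)
  have "mat_poly B (?z l ^ Suc j) = mat_poly B (?z (l ^ j) * ?z l)"
    by (simp only: power_Suc2 mat_poly_mult Suc)
  also have "\<dots> = mat_poly B (1 + (Polynomial.smult ((l ^ j - 1) + (l - 1)) e +
      Polynomial.smult ((l ^ j - 1) * (l - 1)) e))"
    unfolding expand by (simp only: mat_poly_add mat_poly_smult e)
  also have "\<dots> = mat_poly B (?z (l ^ Suc j))"
    by (simp only: smult_add_left[symmetric] coeff)
  finally show ?case .
qed simp

lemma primary_root_of_unity: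
  assumes h: "h \<noteq> 0" "mat_poly B h = 0\<^sub>m n n" and f: "f \<in> monic_irreducibles" and l: "l ^ m = 1"
  obtains z where "mat_poly B (z ^ m) = 1\<^sub>m n"
    "\<forall>g\<in>monic_irreducibles. \<forall>v\<in>mat_poly_kernel B g.
      mat_poly B z *\<^sub>v v = (if g = f then l \<cdot>\<^sub>v v else v)"
proof -
  obtain e where e: "mat_poly B (e * e) = mat_poly B e"
    "\<forall>v\<in>mat_poly_kernel B f. mat_poly B e *\<^sub>v v = v"
    "\<forall>g\<in>monic_irreducibles - {f}. \<forall>v\<in>mat_poly_kernel B g. mat_poly B e *\<^sub>v v = 0\<^sub>v n"
    using primary_projection[OF h f] .
  define z where "z = 1 + Polynomial.smult (l - 1) e"
  have z_vec: "mat_poly B z *\<^sub>v v = v + (l - 1) \<cdot>\<^sub>v (mat_poly B e *\<^sub>v v)"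
    if "v \<in> carrier_vec n" for v
    using that by (simp add: z_def mat_poly_add_vec mat_poly_smult_vec)
  show thesis
  proof (rule that)
    show "mat_poly B (z ^ m) = 1\<^sub>m n"
      unfolding z_def mat_poly_idempotent_scaling_power[OF e(1)] by (simp add: l)
  next
    show "\<forall>g\<in>monic_irreducibles. \<forall>v\<in>mat_poly_kernel B g.
      mat_poly B z *\<^sub>v v = (if g = f then l \<cdot>\<^sub>v v else v)"
    proof (intro ballI)
      fix g v assume g: "g \<in> monic_irreducibles" and v: "v \<in> mat_poly_kernel B g"
      then have "v \<in> carrier_vec n" by (simp add: mat_poly_kernel_iff)
      moreover have "mat_poly B e *\<^sub>v v = (if g = f then v else 0\<^sub>v n)"
        using e(2,3) g v by auto
      ultimately show "mat_poly B z *\<^sub>v v = (if g = f then l \<cdot>\<^sub>v v else v)"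
        by (intro eq_vecI) (auto simp: z_vec algebra_simps)
    qed
  qed
qed

lemma primary_roots_of_unity:
  assumes h: "h \<noteq> 0" "mat_poly B h = 0\<^sub>m n n" and l: "l ^ m = 1" and F: "F \<subseteq> monic_irreducibles"
  obtains Z where "\<forall>S\<in>Fpow F. mat_poly B (Z S ^ m) = 1\<^sub>m n"
    "\<forall>S\<in>Fpow F. \<forall>g\<in>F. \<forall>v\<in>mat_poly_kernel B g.
      mat_poly B (Z S) *\<^sub>v v = (if g \<in> S then l \<cdot>\<^sub>v v else v)"
proof -
  have "\<forall>f\<in>F. \<exists>z. mat_poly B (z ^ m) = 1\<^sub>m n \<and> (\<forall>g\<in>F. \<forall>v\<in>mat_poly_kernel B g.
    mat_poly B z *\<^sub>v v = (if g = f then l \<cdot>\<^sub>v v else v))"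
  proof
    fix f assume "f \<in> F"
    with F have "f \<in> monic_irreducibles" by blast
    then obtain z where "mat_poly B (z ^ m) = 1\<^sub>m n"
      "\<forall>g\<in>monic_irreducibles. \<forall>v\<in>mat_poly_kernel B g.
        mat_poly B z *\<^sub>v v = (if g = f then l \<cdot>\<^sub>v v else v)"
      by (rule primary_root_of_unity[OF h _ l])
    with F show "\<exists>z. mat_poly B (z ^ m) = 1\<^sub>m n \<and> (\<forall>g\<in>F. \<forall>v\<in>mat_poly_kernel B g.
      mat_poly B z *\<^sub>v v = (if g = f then l \<cdot>\<^sub>v v else v))"
      by blast
  qed
  then obtain z where z_power: "\<And>f. f \<in> F \<Longrightarrow> mat_poly B (z f ^ m) = 1\<^sub>m n"
    and z_vec: "\<And>f g v. f \<in> F \<Longrightarrow> g \<in> F \<Longrightarrow> v \<in> mat_poly_kernel B g \<Longrightarrow>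
      mat_poly B (z f) *\<^sub>v v = (if g = f then l \<cdot>\<^sub>v v else v)"
    by metis
  have "mat_poly B (prod z S ^ m) = 1\<^sub>m n" if "finite S" "S \<subseteq> F" for S
    using that
    by (induction S rule: finite_induct) (auto simp: power_mult_distrib mat_poly_mult z_power)
  moreover have "mat_poly B (prod z S) *\<^sub>v v = (if g \<in> S then l \<cdot>\<^sub>v v else v)"
    if "finite S" "S \<subseteq> F" and g: "g \<in> F" and v: "v \<in> mat_poly_kernel B g" for S g v
    using that(1,2)
  proof (induction S rule: finite_induct)
    case empty
    show ?case using v by (simp add: mat_poly_kernel_iff)
  next
    case (insert f S)
    have v_carrier: "v \<in> carrier_vec n" using v by (simp add: mat_poly_kernel_iff)
    have "mat_poly B (prod z (insert f S)) *\<^sub>v v =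
        mat_poly B (z f) *\<^sub>v (if g \<in> S then l \<cdot>\<^sub>v v else v)"
      using insert v_carrier by (simp add: mat_poly_mult_vec)
    then show ?case
      using insert z_vec[OF _ g v, of f] mult_mat_vec[OF mat_poly_carrier v_carrier] by auto
  qed
  ultimately show thesis by (intro that[of "prod z"]) (auto simp: Fpow_def)
qed

definition roots_of_unity :: "nat \<Rightarrow> 'a mat set" where
  "roots_of_unity m = mat_poly B ` {p. mat_poly B (p ^ m) = 1\<^sub>m n}"

lemma root_of_unity_power_inverse:
  assumes r: "mat_poly B (r ^ m) = 1\<^sub>m n" and "m > 0"
  shows "mat_poly B (r ^ (m - 1) * r) = 1\<^sub>m n" "mat_poly B ((r ^ (m - 1)) ^ m) = 1\<^sub>m n"
proof -
  show "mat_poly B (r ^ (m - 1) * r) = 1\<^sub>m n"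
    by (simp only: power_minus_mult[OF \<open>m > 0\<close>] r)
  have "mat_poly B ((r ^ (m - 1)) ^ m) = mat_poly B (r ^ m) ^\<^sub>m (m - 1)"
    by (simp only: mat_poly_power[symmetric] power_mult[symmetric] mult.commute)
  also have "\<dots> = 1\<^sub>m n ^\<^sub>m (m - 1)" by (simp only: r)
  also have "\<dots> = mat_poly B (1 ^ (m - 1))" by (simp only: mat_poly_power mat_poly_1)
  finally show "mat_poly B ((r ^ (m - 1)) ^ m) = 1\<^sub>m n" by simp
qed

lemma mat_poly_X_mult_root_of_unity:
  assumes p: "mat_poly B (p ^ m) = 1\<^sub>m n"
  shows "mat_poly B ([:0, 1:] * p) ^\<^sub>m m = B ^\<^sub>m m"
proof -
  have "mat_poly B ([:0, 1:] * p) ^\<^sub>m m = mat_poly B ([:0, 1:] ^ m * p ^ m)"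
    by (simp only: mat_poly_power[symmetric] power_mult_distrib)
  also have "\<dots> = mat_poly B ([:0, 1:] ^ m)"
    by (simp only: mat_poly_mult p right_mult_one_mat[OF mat_poly_carrier])
  also have "\<dots> = B ^\<^sub>m m" by (simp only: mat_poly_power mat_poly_X)
  finally show ?thesis .
qed

text \<open>
  Roots of unity with the same determinant as \<open>r\<close> are moved to determinant 1 by \<open>r ^ (m - 1)\<close>, the
  inverse of \<open>r\<close>; their products with \<open>B\<close> have the same \<open>m\<close>-th power as \<open>B\<close>.
\<close>

lemma shift_to_power_fibre:
  assumes det_B: "det B = 1" and "m > 0" and r: "mat_poly B (r ^ m) = 1\<^sub>m n"
  obtains U where "U \<in> carrier_mat n n" "det U \<noteq> 0"
    "\<forall>p. mat_poly B (p ^ m) = 1\<^sub>m n \<longrightarrow> det (mat_poly B p) = det (mat_poly B r) \<longrightarrow>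
      det (U * mat_poly B p) = 1 \<and> (U * mat_poly B p) ^\<^sub>m m = B ^\<^sub>m m"
proof -
  define s where "s = r ^ (m - 1)"
  note s = root_of_unity_power_inverse[OF r \<open>m > 0\<close>, folded s_def]
  define U where "U = mat_poly B ([:0, 1:] * s)"
  have U: "U \<in> carrier_mat n n" by (simp only: U_def mat_poly_carrier)
  have "det (mat_poly B s) * det (mat_poly B r) = 1"
    using det_mat_poly_mult[of s r] by (simp add: s(1))
  then have det_U: "det U * det (mat_poly B r) = 1"
    by (simp only: U_def det_mat_poly_mult mat_poly_X det_B mult_1_left)
  have "det (U * mat_poly B p) = 1" "(U * mat_poly B p) ^\<^sub>m m = B ^\<^sub>m m"
    if p: "mat_poly B (p ^ m) = 1\<^sub>m n" "det (mat_poly B p) = det (mat_poly B r)" for p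
  proof -
    show "det (U * mat_poly B p) = 1"
      using det_mult[OF U mat_poly_carrier[of p]] det_U by (simp add: p(2))
    have "mat_poly B ((s * p) ^ m) = 1\<^sub>m n"
      by (simp add: power_mult_distrib mat_poly_mult p(1) s(2))
    then have "mat_poly B ([:0, 1:] * (s * p)) ^\<^sub>m m = B ^\<^sub>m m"
      by (rule mat_poly_X_mult_root_of_unity)
    then show "(U * mat_poly B p) ^\<^sub>m m = B ^\<^sub>m m"
      by (simp only: U_def mat_poly_mult[symmetric] mult.assoc)
  qed
  moreover have "det U \<noteq> 0" using det_U by auto
  ultimately show thesis using U by (intro that) auto
qed

end

context finite_square_matrix
begin

lemma annihilating_polynomial_exists:
  obtains h where "h \<noteq> 0" "mat_poly B h = 0\<^sub>m n n"
proof -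
  have "\<not> inj (\<lambda>j :: nat. mat_poly B (monom 1 j))"
  proof
    assume "inj (\<lambda>j :: nat. mat_poly B (monom 1 j))"
    moreover have "finite (range (\<lambda>j :: nat. mat_poly B (monom 1 j)))"
      by (rule finite_subset[OF _ finite_range_mat_poly]) auto
    ultimately show False using finite_imageD infinite_UNIV_nat by blast
  qed
  then obtain i j :: nat where "i \<noteq> j" and eq: "mat_poly B (monom 1 i) = mat_poly B (monom 1 j)"
    by (auto simp: inj_def)
  define h where "h = monom 1 i + Polynomial.smult (- 1) (monom (1 :: 'a) j)"
  have "coeff h i = 1" using \<open>i \<noteq> j\<close> by (simp add: h_def)
  then have "h \<noteq> 0" by auto
  moreover have "mat_poly B h = mat_poly B (monom 1 j) + (- 1) \<cdot>\<^sub>m mat_poly B (monom 1 j)"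
    by (simp only: h_def mat_poly_add mat_poly_smult eq)
  then have "mat_poly B h = 0\<^sub>m n n" by (auto intro!: eq_matI)
  ultimately show thesis by (rule that)
qed

lemma finite_irreducible_factors: "finite (irreducible_factors B)"
proof -
  obtain h where h: "h \<noteq> 0" "mat_poly B h = 0\<^sub>m n n" using annihilating_polynomial_exists .
  have "irreducible_factors B \<subseteq> {g. lead_coeff g = 1 \<and> degree g \<le> degree h}"
    using irreducible_factor_dvd_annihilator[OF h(2)] dvd_imp_degree_le[OF _ h(1)]
    by (auto simp: irreducible_factors_def dest: monic_irreduciblesD)
  then show ?thesis using finite_monics_degree_le by (rule finite_subset)
qed

lemma finite_roots_of_unity: "finite (roots_of_unity m)"
  unfolding roots_of_unity_def by (rule finite_subset[OF _ finite_range_mat_poly]) auto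

lemma card_roots_of_unity_ge:
  fixes l :: 'a
  assumes l: "l ^ m = 1" "l \<noteq> 1"
  shows "2 ^ card (irreducible_factors B) \<le> card (roots_of_unity m)"
proof -
  let ?F = "irreducible_factors B"
  obtain h where h: "h \<noteq> 0" "mat_poly B h = 0\<^sub>m n n" using annihilating_polynomial_exists .
  obtain Z where Z_power: "\<forall>S\<in>Fpow ?F. mat_poly B (Z S ^ m) = 1\<^sub>m n"
    and Z_vec: "\<forall>S\<in>Fpow ?F. \<forall>g\<in>?F. \<forall>v\<in>mat_poly_kernel B g.
      mat_poly B (Z S) *\<^sub>v v = (if g \<in> S then l \<cdot>\<^sub>v v else v)"
    by (rule primary_roots_of_unity[OF h l(1), of ?F]) (auto simp: irreducible_factors_def)
  have Fpow: "Fpow ?F = Pow ?F"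
    using finite_irreducible_factors by (auto simp: Fpow_def intro: finite_subset)
  have "inj_on (\<lambda>S. mat_poly B (Z S)) (Pow ?F)"
  proof (rule inj_onI)
    fix S T assume S: "S \<in> Pow ?F" and T: "T \<in> Pow ?F"
      and eq: "mat_poly B (Z S) = mat_poly B (Z T)"
    have "g \<in> S \<longleftrightarrow> g \<in> T" if g: "g \<in> ?F" for g
    proof -
      obtain v where v: "v \<in> mat_poly_kernel B g" "v \<noteq> 0\<^sub>v n"
        using g by (auto simp: irreducible_factors_def)
      then have v_carrier: "v \<in> carrier_vec n" by (simp add: mat_poly_kernel_iff)
      with v(2) obtain i where "i < n" "v $ i \<noteq> 0"
        by (metis carrier_vecD eq_vecI index_zero_vec)
      then have "(l \<cdot>\<^sub>v v) $ i \<noteq> v $ i" using v_carrier l(2) by simp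
      then have "l \<cdot>\<^sub>v v \<noteq> v" by auto
      moreover have "(if g \<in> S then l \<cdot>\<^sub>v v else v) = (if g \<in> T then l \<cdot>\<^sub>v v else v)"
        using Z_vec S T g v(1) eq unfolding Fpow by metis
      ultimately show ?thesis by (auto split: if_splits)
    qed
    with S T show "S = T" by blast
  qed
  moreover have "(\<lambda>S. mat_poly B (Z S)) ` Pow ?F \<subseteq> roots_of_unity m"
    using Z_power by (auto simp: Fpow roots_of_unity_def)
  ultimately have "card (Pow ?F) \<le> card (roots_of_unity m)"
    using finite_roots_of_unity by (rule card_inj_on_le)
  then show ?thesis using finite_irreducible_factors by (simp add: card_Pow)
qed

lemma card_roots_of_unity_det_le_fibre:
  assumes "det B = 1" "m > 0"
  shows "card (det -` {d} \<inter> roots_of_unity m) \<le> card {A \<in> carrier (SL n). A ^\<^sub>m m = B ^\<^sub>m m}"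
    (is "card ?D \<le> card ?fibre")
proof (cases "?D = {}")
  case False
  then obtain r where r: "mat_poly B (r ^ m) = 1\<^sub>m n" and det_r: "det (mat_poly B r) = d"
    by (auto simp: roots_of_unity_def)
  obtain U where U: "U \<in> carrier_mat n n" "det U \<noteq> 0"
    and fibre: "\<forall>p. mat_poly B (p ^ m) = 1\<^sub>m n \<longrightarrow> det (mat_poly B p) = d \<longrightarrow>
      det (U * mat_poly B p) = 1 \<and> (U * mat_poly B p) ^\<^sub>m m = B ^\<^sub>m m"
    using shift_to_power_fibre[OF assms r] unfolding det_r .
  obtain V where V: "V \<in> carrier_mat n n" "V * U = 1\<^sub>m n"
    using det_non_zero_imp_unit[OF U] by (auto simp: Units_def ring_mat_simps)
  show ?thesis
  proof (rule card_inj_on_le)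
    show "inj_on (\<lambda>R. U * R) ?D"
    proof (rule inj_on_inverseI)
      fix R assume "R \<in> ?D"
      then have R: "R \<in> carrier_mat n n" by (auto simp: roots_of_unity_def)
      then show "V * (U * R) = R"
        using assoc_mult_mat[OF V(1) U(1) R] by (simp add: V(2))
    qed
    show "(\<lambda>R. U * R) ` ?D \<subseteq> ?fibre"
      using fibre mult_carrier_mat[OF U(1) mat_poly_carrier]
      by (auto simp: roots_of_unity_def carrier_SL_iff)
  qed (rule finite_subset[OF _ finite_carrier_SL[of n]], auto)
qed simp

lemma card_irreducible_factors_le_fibre:
  fixes l :: 'a
  assumes "det B = 1" "m > 0" "l ^ m = 1" "l \<noteq> 1"
  shows "2 ^ card (irreducible_factors B) \<le>
    CARD('a) * card {A \<in> carrier (SL n). A ^\<^sub>m m = B ^\<^sub>m m}"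
proof -
  have "\<exists>d\<in>UNIV. card (roots_of_unity m) \<le> card (det -` {d} \<inter> roots_of_unity m) * CARD('a)"
    using finite_roots_of_unity by (intro pigeonhole_card) auto
  then obtain d where
    "card (roots_of_unity m) \<le> card (det -` {d} \<inter> roots_of_unity m) * CARD('a)" ..
  also have "\<dots> \<le> card {A \<in> carrier (SL n). A ^\<^sub>m m = B ^\<^sub>m m} * CARD('a)"
    using assms(1,2) by (intro mult_le_mono1 card_roots_of_unity_det_le_fibre)
  finally show ?thesis
    using card_roots_of_unity_ge[OF assms(3,4)] by (simp add: mult.commute)
qed

end

section \<open>Power images in the special linear group\<close>

lemma (in finite_square_matrix) card_irreducible_factors_ge:
  fixes K :: nat
  assumes disjoint: "disjoint_family_on \<F> {..<K}"
    and irreducible: "\<And>i. i < K \<Longrightarrow> \<F> i \<subseteq> monic_irreducibles"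
    and embedding: "\<And>i. i < K \<Longrightarrow> \<exists>f\<in>\<F> i. embeddings B f \<noteq> {}"
  shows "K \<le> card (irreducible_factors B)"
proof -
  obtain f where f: "\<And>i. i < K \<Longrightarrow> f i \<in> \<F> i" "\<And>i. i < K \<Longrightarrow> embeddings B (f i) \<noteq> {}"
    using embedding by metis
  have "inj_on f {..<K}"
    using f(1) disjoint_family_onD[OF disjoint]
    by (intro inj_onI) (metis IntI empty_iff lessThan_iff)
  moreover have "f ` {..<K} \<subseteq> irreducible_factors B"
    using f irreducible by (blast intro: embedding_imp_irreducible_factor)
  ultimately have "card {..<K} \<le> card (irreducible_factors B)"
    using finite_irreducible_factors by (rule card_inj_on_le)
  then show ?thesis by simp
qed

lemma card_few_irreducible_factors_le:
  fixes \<F> :: "nat \<Rightarrow> 'a :: {field, finite} poly set" and L :: real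
  assumes disjoint: "disjoint_family_on \<F> {..<K}"
    and finite: "\<And>i. i < K \<Longrightarrow> finite (\<F> i)"
    and irreducible: "\<And>i. i < K \<Longrightarrow> \<F> i \<subseteq> monic_irreducibles - {[:0, 1:]}"
    and mass: "\<And>i. i < K \<Longrightarrow> L \<le> (\<Sum>f\<in>\<F> i. reciprocal_norm f)"
    and n: "\<And>i f. i < K \<Longrightarrow> f \<in> \<F> i \<Longrightarrow> 2 * degree f < n" and "L \<ge> 0"
  shows "card {B \<in> carrier (SL n :: 'a mat monoid). card (irreducible_factors B) < K} * L \<le>
    K * order (SL n :: 'a mat monoid)"
proof -
  let ?G = "carrier (SL n :: 'a mat monoid)"
  define bad where "bad i = {B \<in> ?G. \<forall>f\<in>\<F> i. embeddings B f = {}}" for i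
  have "{B \<in> ?G. card (irreducible_factors B) < K} \<subseteq> (\<Union>i<K. bad i)"
  proof
    fix B assume B: "B \<in> {B \<in> ?G. card (irreducible_factors B) < K}"
    then interpret finite_square_matrix n B
      by unfold_locales (auto intro: carrier_SL_carrier_mat)
    show "B \<in> (\<Union>i<K. bad i)"
    proof (rule ccontr)
      assume "B \<notin> (\<Union>i<K. bad i)"
      with B have "\<exists>f\<in>\<F> i. embeddings B f \<noteq> {}" if "i < K" for i
        using that by (auto simp: bad_def)
      then have "K \<le> card (irreducible_factors B)"
        using irreducible by (intro card_irreducible_factors_ge[OF disjoint]) auto
      with B show False by simp
    qed
  qed
  then have "card {B \<in> ?G. card (irreducible_factors B) < K} \<le> card (\<Union>i<K. bad i)"
    by (intro card_mono) (auto simp: bad_def finite_carrier_SL)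
  also have "\<dots> \<le> (\<Sum>i<K. card (bad i))" by (rule card_UN_le) simp
  finally have "real (card {B \<in> ?G. card (irreducible_factors B) < K}) \<le> real (\<Sum>i<K. card (bad i))"
    by (simp only: of_nat_le_iff)
  then have "card {B \<in> ?G. card (irreducible_factors B) < K} * L \<le> (\<Sum>i<K. card (bad i)) * L"
    using \<open>L \<ge> 0\<close> by (rule mult_right_mono)
  also have "\<dots> = (\<Sum>i<K. card (bad i) * L)" by (simp add: sum_distrib_right)
  also have "\<dots> \<le> (\<Sum>i<K. order (SL n :: 'a mat monoid))"
    unfolding of_nat_sum
  proof (rule sum_mono)
    fix i assume "i \<in> {..<K}"
    then have i: "i < K" by simp
    have "card (bad i) * L \<le> card (bad i) * (\<Sum>f\<in>\<F> i. reciprocal_norm f)"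
      using mass[OF i] by (intro mult_left_mono) auto
    also have "\<dots> \<le> order (SL n :: 'a mat monoid)"
      unfolding bad_def using finite[OF i] irreducible[OF i] n[OF i] by (rule card_no_embedding_le)
    finally show "card (bad i) * L \<le> order (SL n :: 'a mat monoid)" .
  qed
  finally show ?thesis by simp
qed

lemma few_irreducible_factors_rare:
  fixes \<epsilon> :: real and K :: nat
  assumes "\<epsilon> > 0"
  obtains n where "n \<ge> 2"
    "card {B \<in> carrier (SL n :: 'a :: {field, finite} mat monoid).
        card (irreducible_factors B) < K} \<le> \<epsilon> * order (SL n :: 'a mat monoid)"
proof -
  define L where "L = (K + 1) / \<epsilon>"
  have "L > 0" and K_le: "K \<le> \<epsilon> * L" using \<open>\<epsilon> > 0\<close> by (simp_all add: L_def)
  obtain \<F> :: "nat \<Rightarrow> 'a poly set" where disjoint: "disjoint_family_on \<F> {..<K}"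
    and finite: "\<And>i. i < K \<Longrightarrow> finite (\<F> i)"
    and irreducible: "\<And>i. i < K \<Longrightarrow> \<F> i \<subseteq> monic_irreducibles - {[:0, 1:]}"
    and mass: "\<And>i. i < K \<Longrightarrow> L \<le> (\<Sum>f\<in>\<F> i. reciprocal_norm f)"
    by (rule disjoint_irreducible_families[of "{[:0, 1:]}"]) (auto simp: X_in_monic_irreducibles)
  define n where "n = 3 + (\<Sum>f\<in>(\<Union>i<K. \<F> i). 2 * degree f)"
  have n: "2 * degree f < n" if "i < K" "f \<in> \<F> i" for i f
  proof -
    have "2 * degree f \<le> (\<Sum>f\<in>(\<Union>i<K. \<F> i). 2 * degree f)"
      using that finite by (intro member_le_sum) auto
    then show ?thesis by (simp add: n_def)
  qed
  let ?few = "{B \<in> carrier (SL n :: 'a mat monoid). card (irreducible_factors B) < K}"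
  have "card ?few * L \<le> K * order (SL n :: 'a mat monoid)"
    using disjoint finite irreducible mass n \<open>L > 0\<close>
    by (intro card_few_irreducible_factors_le) auto
  also have "\<dots> \<le> (\<epsilon> * order (SL n :: 'a mat monoid)) * L"
    using mult_right_mono[OF K_le, of "order (SL n :: 'a mat monoid)"] by (simp add: mult_ac)
  finally have "card ?few \<le> \<epsilon> * order (SL n :: 'a mat monoid)"
    using \<open>L > 0\<close> by simp
  then show thesis by (intro that[of n]) (auto simp: n_def)
qed

lemma card_image_mult_le:
  fixes k c :: nat
  assumes "finite X" "S \<subseteq> X" and fibre: "\<And>x. x \<in> S \<Longrightarrow> k \<le> c * card {y \<in> X. g y = g x}"
  shows "card (g ` S) * k \<le> c * card X"
proof -
  have "finite S" using assms(2,1) by (rule finite_subset)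
  have "card (g ` S) * k = (\<Sum>z\<in>g ` S. k)" by simp
  also have "\<dots> \<le> (\<Sum>z\<in>g ` S. c * card {y \<in> X. g y = z})"
    using fibre by (intro sum_mono) auto
  also have "\<dots> = c * card (\<Union>z\<in>g ` S. {y \<in> X. g y = z})"
    using \<open>finite X\<close> \<open>finite S\<close> by (subst card_UN_disjoint) (auto simp: sum_distrib_left)
  also have "\<dots> \<le> c * card X"
    using \<open>finite X\<close> by (intro mult_left_mono card_mono) auto
  finally show ?thesis .
qed

lemma power_word_image_altdef: "power_word_image M G = (\<lambda>g. g [^]\<^bsub>G\<^esub> M) ` carrier G"
  by (auto simp: power_word_image_def)

lemma power_word_image_SL: "power_word_image m (SL n) = (\<lambda>A. A ^\<^sub>m m) ` carrier (SL n)"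
proof -
  have "A [^]\<^bsub>SL n\<^esub> m = A ^\<^sub>m m" if "A \<in> carrier (SL n)" for A :: "'a mat"
  proof -
    have "dim_row A = n" using that by (auto simp: carrier_SL_iff)
    then show ?thesis by (induction m) (simp_all add: mult_SL one_SL)
  qed
  then show ?thesis unfolding power_word_image_altdef by (rule image_cong[OF refl])
qed

lemma card_power_image_many_factors_le:
  fixes l :: "'a :: {field, finite}"
  assumes l: "l ^ m = 1" "l \<noteq> 1" and "m > 0"
  shows "card ((\<lambda>A. A ^\<^sub>m m) `
      {B \<in> carrier (SL n :: 'a mat monoid). K \<le> card (irreducible_factors B)}) * 2 ^ K \<le>
    CARD('a) * order (SL n :: 'a mat monoid)"
  unfolding order_def
proof (rule card_image_mult_le[OF finite_carrier_SL])
  let ?G = "carrier (SL n :: 'a mat monoid)"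
  fix B assume B: "B \<in> {B \<in> ?G. K \<le> card (irreducible_factors B)}"
  then interpret finite_square_matrix n B
    by unfold_locales (auto intro: carrier_SL_carrier_mat)
  have "2 ^ K \<le> (2 :: nat) ^ card (irreducible_factors B)"
    using B by (intro power_increasing) auto
  also have "\<dots> \<le> CARD('a) * card {A \<in> ?G. A ^\<^sub>m m = B ^\<^sub>m m}"
    using B \<open>m > 0\<close> l by (intro card_irreducible_factors_le_fibre) (auto simp: carrier_SL_iff)
  finally show "2 ^ K \<le> CARD('a) * card {A \<in> ?G. A ^\<^sub>m m = B ^\<^sub>m m}" .
qed auto

lemma SL_power_image_small:
  fixes l :: "'a :: {field, finite}" and \<epsilon> :: real
  assumes l: "l ^ m = 1" "l \<noteq> 1" and "m > 0" and "\<epsilon> > 0"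
  obtains n where "n \<ge> 2"
    "card (power_word_image m (SL n :: 'a mat monoid)) \<le> \<epsilon> * order (SL n :: 'a mat monoid)"
proof -
  obtain K where "2 * CARD('a) / \<epsilon> < 2 ^ K"
    using real_arch_pow[of 2 "2 * CARD('a) / \<epsilon>"] by auto
  then have K: "CARD('a) \<le> \<epsilon> / 2 * 2 ^ K" using \<open>\<epsilon> > 0\<close> by (simp add: field_simps)
  obtain n where "n \<ge> 2" and few_le:
    "card {B \<in> carrier (SL n :: 'a mat monoid). card (irreducible_factors B) < K} \<le>
      \<epsilon> / 2 * order (SL n :: 'a mat monoid)"
    using few_irreducible_factors_rare[of "\<epsilon> / 2" K] \<open>\<epsilon> > 0\<close> by auto
  let ?G = "carrier (SL n :: 'a mat monoid)" and ?pow = "\<lambda>A :: 'a mat. A ^\<^sub>m m"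
  define few many where "few = {B \<in> ?G. card (irreducible_factors B) < K}"
    and "many = {B \<in> ?G. K \<le> card (irreducible_factors B)}"
  have "real (card (?pow ` many) * 2 ^ K) \<le> real (CARD('a) * order (SL n :: 'a mat monoid))"
    unfolding many_def of_nat_le_iff by (rule card_power_image_many_factors_le[OF l \<open>m > 0\<close>])
  also have "\<dots> \<le> (\<epsilon> / 2 * order (SL n :: 'a mat monoid)) * 2 ^ K"
    using mult_right_mono[OF K, of "order (SL n :: 'a mat monoid)"] by (simp add: mult_ac)
  finally have many_le: "card (?pow ` many) \<le> \<epsilon> / 2 * order (SL n :: 'a mat monoid)"
    by simp
  have "?G = many \<union> few" by (auto simp: few_def many_def)
  then have "card (power_word_image m (SL n :: 'a mat monoid)) \<le>
      card (?pow ` many) + card (?pow ` few)"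
    by (simp only: power_word_image_SL image_Un card_Un_le)
  also have "card (?pow ` few) \<le> card few"
    by (intro card_image_le) (auto simp: few_def finite_carrier_SL)
  finally have "real (card (power_word_image m (SL n :: 'a mat monoid))) \<le>
      card (?pow ` many) + card few" by linarith
  also have "\<dots> \<le> \<epsilon> * order (SL n :: 'a mat monoid)"
    using many_le few_le unfolding few_def by linarith
  finally show thesis using \<open>n \<ge> 2\<close> by (intro that)
qed

section \<open>Passage to the projective special linear group\<close>

lemma group_center_SL_entries:
  fixes z :: "'a :: field mat"
  assumes z: "z \<in> group_center (SL n)" and kl: "k < n" "l < n" "k \<noteq> l"
  shows "z $$ (l, k) = 0" "z $$ (k, k) = z $$ (l, l)"
proof -
  have z_carrier: "z \<in> carrier_mat n n" using z by (simp add: group_center_def carrier_SL_iff)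
  have "addrow_mat n 1 k l \<in> carrier (SL n :: 'a mat monoid)"
    using kl by (simp add: carrier_SL_iff det_addrow_mat)
  then have "z * addrow_mat n 1 k l = addrow_mat n 1 k l * z"
    using z by (auto simp: group_center_def mult_SL)
  then have eq: "addcol 1 l k z = addrow 1 k l z"
    using addcol_mat[OF z_carrier kl(1)] addrow_mat[OF z_carrier kl(2)] by simp
  have "addcol 1 l k z $$ (l, l) = addrow 1 k l z $$ (l, l)"
    "addcol 1 l k z $$ (k, l) = addrow 1 k l z $$ (k, l)" by (simp_all add: eq)
  then show "z $$ (l, k) = 0" "z $$ (k, k) = z $$ (l, l)" using z_carrier kl by auto
qed

lemma group_center_SL_scalar:
  assumes z: "z \<in> group_center (SL n)"
  shows "z = z $$ (0, 0) \<cdot>\<^sub>m 1\<^sub>m n"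
proof (rule eq_matI)
  fix i j assume "i < dim_row (z $$ (0, 0) \<cdot>\<^sub>m 1\<^sub>m n)" "j < dim_col (z $$ (0, 0) \<cdot>\<^sub>m 1\<^sub>m n)"
  then have ij: "i < n" "j < n" by auto
  show "z $$ (i, j) = (z $$ (0, 0) \<cdot>\<^sub>m 1\<^sub>m n) $$ (i, j)"
  proof (cases "i = j")
    case True
    then show ?thesis using group_center_SL_entries(2)[OF z, of i 0] ij by (cases "i = 0") auto
  next
    case False
    then show ?thesis using group_center_SL_entries(1)[OF z, of j i] ij by simp
  qed
qed (use z in \<open>auto simp: group_center_def carrier_SL_iff\<close>)

lemma card_group_center_SL_le:
  "card (group_center (SL n :: 'a :: {field, finite} mat monoid)) \<le> CARD('a)"
proof (rule card_inj_on_le)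
  show "inj_on (\<lambda>z. z $$ (0, 0)) (group_center (SL n :: 'a mat monoid))"
  proof (rule inj_onI)
    fix z w :: "'a mat"
    assume z: "z \<in> group_center (SL n)" and w: "w \<in> group_center (SL n)"
      and eq: "z $$ (0, 0) = w $$ (0, 0)"
    show "z = w"
      using group_center_SL_scalar[OF z, unfolded eq] group_center_SL_scalar[OF w, symmetric]
      by (rule trans)
  qed
qed auto

lemma (in normal) power_word_image_Mod:
  "power_word_image M (G Mod H) = (\<lambda>a. H #> a) ` power_word_image M G"
proof -
  have coset_pow: "(H #> a) [^]\<^bsub>G Mod H\<^esub> M = H #> (a [^] M)" if "a \<in> carrier G" for a
    using hom_nat_pow[OF r_coset_hom_Mod that is_group factorgroup_is_group] by simp
  have "carrier (G Mod H) = (\<lambda>a. H #> a) ` carrier G"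
    by (auto simp: FactGroup_def RCOSETS_def)
  then have "power_word_image M (G Mod H) = (\<lambda>a. (H #> a) [^]\<^bsub>G Mod H\<^esub> M) ` carrier G"
    by (simp only: power_word_image_altdef image_image)
  also have "\<dots> = (\<lambda>a. H #> (a [^] M)) ` carrier G"
    using coset_pow by (rule image_cong[OF refl])
  also have "\<dots> = (\<lambda>a. H #> a) ` power_word_image M G"
    by (simp only: power_word_image_altdef image_image)
  finally show ?thesis .
qed

lemma order_SL_le_PSL:
  "order (SL n :: 'a :: {field, finite} mat monoid) \<le>
    CARD('a) * order (PSL n :: 'a mat set monoid)"
proof -
  interpret Z: normal "group_center (SL n)" "SL n :: 'a mat monoid"
    by (rule SL.group_center_normal)
  have "order (SL n :: 'a mat monoid) =
      order (PSL n :: 'a mat set monoid) * card (group_center (SL n :: 'a mat monoid))"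
    using SL.lagrange[OF Z.is_subgroup] by (simp add: PSL_def order_def FactGroup_def)
  then show ?thesis
    using card_group_center_SL_le[of n, where 'a = 'a] by (simp add: mult.commute)
qed

lemma card_power_word_image_PSL_le:
  "card (power_word_image M (PSL n :: 'a :: {field, finite} mat set monoid)) \<le>
    card (power_word_image M (SL n :: 'a mat monoid))"
proof -
  interpret Z: normal "group_center (SL n)" "SL n :: 'a mat monoid"
    by (rule SL.group_center_normal)
  show ?thesis
    unfolding PSL_def Z.power_word_image_Mod
    by (intro card_image_le) (simp add: power_word_image_SL finite_carrier_SL)
qed

lemma PSL_power_image_small:
  fixes l :: "'a :: {field, finite}" and \<epsilon> :: real
  assumes l: "l ^ m = 1" "l \<noteq> 1" and "m > 0" and "\<epsilon> > 0"
  obtains n where "n \<ge> 2"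
    "card (power_word_image m (PSL n :: 'a mat set monoid)) \<le>
      \<epsilon> * order (PSL n :: 'a mat set monoid)"
proof -
  have q: "CARD('a) > 0" by simp
  then have "\<epsilon> / CARD('a) > 0" using \<open>\<epsilon> > 0\<close> by simp
  with l \<open>m > 0\<close> obtain n where "n \<ge> 2" and small:
    "card (power_word_image m (SL n :: 'a mat monoid)) \<le>
      \<epsilon> / CARD('a) * order (SL n :: 'a mat monoid)"
    by (rule SL_power_image_small)
  have "real (card (power_word_image m (PSL n :: 'a mat set monoid))) \<le>
      card (power_word_image m (SL n :: 'a mat monoid))"
    using card_power_word_image_PSL_le by simp
  also note small
  also have "\<epsilon> / CARD('a) * order (SL n :: 'a mat monoid) \<le>
      \<epsilon> / CARD('a) * (CARD('a) * order (PSL n :: 'a mat set monoid))"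
    using \<open>\<epsilon> > 0\<close> order_SL_le_PSL[of n, where 'a = 'a]
    by (intro mult_left_mono) (auto simp flip: of_nat_mult)
  also have "\<dots> = \<epsilon> * order (PSL n :: 'a mat set monoid)" using q by simp
  finally show thesis using \<open>n \<ge> 2\<close> by (intro that)
qed

lemma card_power_word_image_pos:
  assumes "group G" and "finite (carrier G)"
  shows "card (power_word_image M G) > 0"
proof -
  interpret group G by fact
  show ?thesis
    using assms(2) one_closed unfolding power_word_image_altdef by (auto simp: card_gt_0_iff)
qed

lemma finite_carrier_PSL: "finite (carrier (PSL n :: 'a :: {field, finite} mat set monoid))"
  by (simp add: PSL_def FactGroup_def RCOSETS_def finite_carrier_SL)

lemma finite_field_power_card:
  fixes x :: "'a :: {field, finite}"
  assumes "x \<noteq> 0"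
  shows "x ^ (CARD('a) - 1) = 1"
proof -
  let ?U = "UNIV - {0 :: 'a}"
  have "bij_betw (\<lambda>y. x * y) ?U ?U"
    using assms by (intro bij_betwI[where g = "\<lambda>y. y / x"]) auto
  from prod.reindex_bij_betw[OF this, of "\<lambda>y. y"]
  have "x ^ card ?U * \<Prod>?U = \<Prod>?U" by (simp add: prod.distrib)
  moreover have "\<Prod>?U \<noteq> 0" by simp
  ultimately show ?thesis by (simp add: card_Diff_singleton)
qed

lemma nontrivial_root_of_unity_exists:
  assumes "CARD('a) > 2"
  obtains l :: "'a :: {field, finite}" where "l ^ (CARD('a) - 1) = 1" "l \<noteq> 1"
proof -
  have "card {0 :: 'a, 1} < CARD('a)" using assms by simp
  then obtain l :: 'a where "l \<notin> {0, 1}" by (metis UNIV_I card_mono finite leD subsetI)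
  then show thesis using finite_field_power_card by (intro that) auto
qed

theorem theorem1p5:
  fixes q M :: nat
  assumes "primepow q" and "q > 2"
    and "CARD('a :: {field, finite}) = q"
    and "M = q - 1"
  shows "\<forall>(N :: nat) (c :: real). c > 0 \<longrightarrow>
    (\<exists>n \<ge> 2. let G = (PSL n :: 'a mat set monoid) in
      order G \<ge> N \<and> real (card (power_word_image M G)) < c * real (order G))"
proof (intro allI impI)
  fix N :: nat and c :: real assume "c > 0"
  obtain l :: 'a where l: "l ^ M = 1" "l \<noteq> 1"
    using nontrivial_root_of_unity_exists assms by blast
  have "M > 0" using assms by simp
  define \<epsilon> where "\<epsilon> = min (c / 2) (1 / (N + 1))"
  have "\<epsilon> > 0" using \<open>c > 0\<close> by (simp add: \<epsilon>_def)
  with l \<open>M > 0\<close> obtain n where "n \<ge> 2" and small: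
    "card (power_word_image M (PSL n :: 'a mat set monoid)) \<le>
      \<epsilon> * order (PSL n :: 'a mat set monoid)"
    by (rule PSL_power_image_small)
  let ?G = "PSL n :: 'a mat set monoid"
  have one_le: "1 \<le> \<epsilon> * order ?G"
    using card_power_word_image_pos[OF group_PSL finite_carrier_PSL, of M n, where 'a1 = 'a] small
    by linarith
  also have "\<dots> \<le> 1 / (N + 1) * order ?G" by (intro mult_right_mono) (auto simp: \<epsilon>_def)
  finally have "N + 1 \<le> real (order ?G)" by (simp add: field_simps)
  moreover have "\<epsilon> * order ?G \<le> c / 2 * order ?G" by (intro mult_right_mono) (auto simp: \<epsilon>_def)
  then have "card (power_word_image M ?G) < c * order ?G" using small one_le by linarith
  ultimately show "\<exists>n \<ge> 2. let G = (PSL n :: 'a mat set monoid) in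
      order G \<ge> N \<and> real (card (power_word_image M G)) < c * real (order G)"
    using \<open>n \<ge> 2\<close> unfolding Let_def by (intro exI[of _ n]) auto
qed

end
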